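(* Every locally finite-dimensional $C^*$-algebra $A$ satisfies $\operatorname{gr}(A)\le 1$. If $A$ is a separable AF-algebra, then a generic element of $A$ is a generator, that is, $\{a\in A: C^*(a)=A\}$ is a dense $G_\delta$-subset of $A$. In particular, $A$ is singly generated, that is, there exists $a\in A$ with $C^*(a)=A$.
   Context: Notation: for a $C^*$-algebra $A$, $A_{\mathrm{sa}}$ is the set of self-adjoint elements; $C^*(b_0,\dots,b_n)$ is the (not necessarily unital) sub-$C^*$-algebra generated by $b_0,\dots,b_n$; $\widetilde{A}$ is the minimal unitization ($\widetilde A=A$ if $A$ is unital). For $G\subseteq A$, $c\in_\varepsilon G$ means that there is $g\in G$ with $\|c-g\|<\varepsilon$. A $C^*$-algebra $A$ is locally finite-dimensional if for every finite subset $F\subseteq A$ and $\varepsilon>0$ there exists a finite-dimensional sub-$C^*$-algebra $B\subseteq A$ such that $x\in_\varepsilon B$ for every $x\in F$. An AF-algebra is a $C^*$-algebra isomorphic to an inductive limit of finite-dimensional $C^*$-algebras. $\operatorname{gr}_0(A)$ is the smallest integer $n\ge 0$ such that for all $a_0,\dots,a_n\in A_{\mathrm{sa}}$, $\varepsilon>0$ and $c\in A$ there exist $b_0,\dots,b_n\in A_{\mathrm{sa}}$ with $\|b_j-a_j\|<\varepsilon$ for $j=0,\dots,n$ and $c\in_\varepsilon C^*(b_0,\dots,b_n)$; $\operatorname{gr}_0(A)=\infty$ if no such $n$ exists. The generator rank of $A$ is $\operatorname{gr}(A):=\operatorname{gr}_0(\widetilde A)$. *)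

theory Defs
  imports "HOL-Analysis.Analysis" "HOL-Library.Extended_Nat"
begin

section \<open>C*-algebras\<close>

text \<open>Complex C*-algebras, not necessarily unital; the zero algebra is allowed.\<close>

class cstar_algebra = real_normed_algebra + banach +
  fixes scaleC :: "complex \<Rightarrow> 'a \<Rightarrow> 'a" (infixr "*\<^sub>C" 75)
    and star :: "'a \<Rightarrow> 'a"
  assumes scaleC_add_right: "c *\<^sub>C (x + y) = c *\<^sub>C x + c *\<^sub>C y"
    and scaleC_add_left: "(c + d) *\<^sub>C x = c *\<^sub>C x + d *\<^sub>C x"
    and scaleC_scaleC: "c *\<^sub>C d *\<^sub>C x = (c * d) *\<^sub>C x"
    and scaleC_one: "1 *\<^sub>C x = x"
    and scaleR_conv_scaleC: "r *\<^sub>R x = complex_of_real r *\<^sub>C x"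
    and norm_scaleC: "norm (c *\<^sub>C x) = cmod c * norm x"
    and mult_scaleC_left: "(c *\<^sub>C x) * y = c *\<^sub>C (x * y)"
    and mult_scaleC_right: "x * (c *\<^sub>C y) = c *\<^sub>C (x * y)"
    and star_add: "star (x + y) = star x + star y"
    and star_scaleC: "star (c *\<^sub>C x) = cnj c *\<^sub>C star x"
    and star_mult: "star (x * y) = star y * star x"
    and star_star: "star (star x) = x"
    and cstar_identity: "norm (star x * x) = (norm x)\<^sup>2"

global_interpretation cvec: vector_space "scaleC :: complex \<Rightarrow> 'a \<Rightarrow> 'a::cstar_algebra"
  by unfold_locales (rule scaleC_add_right scaleC_add_left scaleC_scaleC scaleC_one)+

definition selfadjoint :: "'a::cstar_algebra \<Rightarrow> bool"
  where "selfadjoint a \<longleftrightarrow> star a = a"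

definition unital :: "'a::cstar_algebra itself \<Rightarrow> bool"
  where "unital _ \<longleftrightarrow> (\<exists>e::'a. \<forall>x. e * x = x \<and> x * e = x)"

definition sub_cstar :: "'a::cstar_algebra set \<Rightarrow> bool"
  where "sub_cstar S \<longleftrightarrow> cvec.subspace S \<and> (\<forall>x\<in>S. \<forall>y\<in>S. x * y \<in> S) \<and>
    (\<forall>x\<in>S. star x \<in> S) \<and> closed S"

definition cstar_generated :: "'a::cstar_algebra set \<Rightarrow> 'a set"
  where "cstar_generated G = sub_cstar hull G"

definition fin_dim :: "'a::cstar_algebra set \<Rightarrow> bool"
  where "fin_dim S \<longleftrightarrow> (\<exists>X. finite X \<and> cvec.span X = S)"

definition approx_in :: "real \<Rightarrow> 'a::cstar_algebra \<Rightarrow> 'a set \<Rightarrow> bool"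
  where "approx_in \<epsilon> c G \<longleftrightarrow> (\<exists>g\<in>G. norm (c - g) < \<epsilon>)"

definition locally_fin_dim :: "'a::cstar_algebra itself \<Rightarrow> bool"
  where "locally_fin_dim _ \<longleftrightarrow>
    (\<forall>F::'a set. \<forall>\<epsilon>>0. finite F \<longrightarrow>
       (\<exists>B. sub_cstar B \<and> fin_dim B \<and> (\<forall>x\<in>F. approx_in \<epsilon> x B)))"

section \<open>Inductive limits and AF-algebras\<close>

definition star_hom_on :: "'a::cstar_algebra set \<Rightarrow> ('a \<Rightarrow> 'b::cstar_algebra) \<Rightarrow> bool"
  where "star_hom_on S f \<longleftrightarrow>
    (\<forall>x\<in>S. \<forall>y\<in>S. f (x + y) = f x + f y) \<and>
    (\<forall>c. \<forall>x\<in>S. f (c *\<^sub>C x) = c *\<^sub>C f x) \<and>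
    (\<forall>x\<in>S. \<forall>y\<in>S. f (x * y) = f x * f y) \<and>
    (\<forall>x\<in>S. f (star x) = star (f x))"

text \<open>A family of C*-algebras is given by sub-C*-algebras of one common C*-algebra
  \<open>'b\<close>. Up to isomorphism this is no restriction, as every family embeds
  into its bounded product. The index set is an arbitrary nonempty directed preordered set;
  the connecting maps need not be injective.\<close>

definition inductive_system ::
    "'i set \<Rightarrow> ('i \<Rightarrow> 'i \<Rightarrow> bool) \<Rightarrow> ('i \<Rightarrow> 'b::cstar_algebra set) \<Rightarrow>
     ('i \<Rightarrow> 'i \<Rightarrow> 'b \<Rightarrow> 'b) \<Rightarrow> bool"
  where "inductive_system I le B \<phi> \<longleftrightarrow>
    I \<noteq> {} \<and>
    (\<forall>i\<in>I. le i i) \<and>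
    (\<forall>i\<in>I. \<forall>j\<in>I. \<forall>k\<in>I. le i j \<longrightarrow> le j k \<longrightarrow> le i k) \<and>
    (\<forall>i\<in>I. \<forall>j\<in>I. \<exists>k\<in>I. le i k \<and> le j k) \<and>
    (\<forall>i\<in>I. sub_cstar (B i)) \<and>
    (\<forall>i\<in>I. \<forall>j\<in>I. le i j \<longrightarrow> star_hom_on (B i) (\<phi> i j) \<and> \<phi> i j ` B i \<subseteq> B j) \<and>
    (\<forall>i\<in>I. \<forall>x\<in>B i. \<phi> i i x = x) \<and>
    (\<forall>i\<in>I. \<forall>j\<in>I. \<forall>k\<in>I. le i j \<longrightarrow> le j k \<longrightarrow> (\<forall>x\<in>B i. \<phi> j k (\<phi> i j x) = \<phi> i k x))"

text \<open>The C*-algebraic inductive limit is the completion of the algebraic direct limit with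
  respect to the C*-seminorm sending the class of \<open>x \<in> B i\<close> to
  \<open>lim\<^sub>j \<parallel>\<phi> i j x\<parallel> = inf\<^sub>j \<parallel>\<phi> i j x\<parallel>\<close> (a *-homomorphism is
  contractive, so the net decreases). To say that
  \<open>'a\<close> is (isomorphic to) this completion is to give a *-homomorphism from the
  algebraic direct limit to \<open>'a\<close>, that is, a compatible family \<open>\<mu>\<close>,
  which preserves the seminorm and has dense range.\<close>

definition is_inductive_limit ::
    "'i set \<Rightarrow> ('i \<Rightarrow> 'i \<Rightarrow> bool) \<Rightarrow> ('i \<Rightarrow> 'b::cstar_algebra set) \<Rightarrow>
     ('i \<Rightarrow> 'i \<Rightarrow> 'b \<Rightarrow> 'b) \<Rightarrow> ('i \<Rightarrow> 'b \<Rightarrow> 'a::cstar_algebra) \<Rightarrow> bool"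
  where "is_inductive_limit I le B \<phi> \<mu> \<longleftrightarrow>
    inductive_system I le B \<phi> \<and>
    (\<forall>i\<in>I. star_hom_on (B i) (\<mu> i)) \<and>
    (\<forall>i\<in>I. \<forall>j\<in>I. le i j \<longrightarrow> (\<forall>x\<in>B i. \<mu> j (\<phi> i j x) = \<mu> i x)) \<and>
    (\<forall>i\<in>I. \<forall>x\<in>B i. norm (\<mu> i x) = (INF j\<in>{j\<in>I. le i j}. norm (\<phi> i j x))) \<and>
    closure (\<Union>i\<in>I. \<mu> i ` B i) = UNIV"

text \<open>The types \<open>'i\<close> of indices and \<open>'b\<close> of the ambient algebra
  cannot be quantified inside the definition; they are parameters, and a hypothesis
  \<open>AF_algebra TYPE('i) TYPE('b) TYPE('a)\<close> with type variables
  \<open>'i\<close> and \<open>'b\<close> covers all inductive systems.\<close>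

definition AF_algebra ::
    "'i itself \<Rightarrow> 'b::cstar_algebra itself \<Rightarrow> 'a::cstar_algebra itself \<Rightarrow> bool"
  where "AF_algebra _ _ _ \<longleftrightarrow>
    (\<exists>(I::'i set) le (B::'i \<Rightarrow> 'b set) \<phi> (\<mu>::'i \<Rightarrow> 'b \<Rightarrow> 'a).
       is_inductive_limit I le B \<phi> \<mu> \<and> (\<forall>i\<in>I. fin_dim (B i)))"

section \<open>Adjoining a unit\<close>

lemma star_zero [simp]: "star (0::'a::cstar_algebra) = 0"
  by (metis add_cancel_right_right star_add)

lemma star_minus: "star (- x::'a::cstar_algebra) = - star x"
  by (metis add.right_inverse add_eq_0_iff star_add star_zero)

lemma norm_star [simp]: "norm (star x) = norm (x::'a::cstar_algebra)"
proof -
  have le: "norm y \<le> norm (star y)" for y :: 'a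
  proof (cases "norm y = 0")
    case False
    have "norm y * norm y \<le> norm (star y) * norm y"
      using cstar_identity[of y] norm_mult_ineq[of "star y" y] by (simp add: power2_eq_square)
    then show ?thesis using False by simp
  qed simp
  show ?thesis using le[of x] le[of "star x"] by (simp add: star_star)
qed

text \<open>\<open>Unz a \<lambda>\<close> stands for \<open>a + \<lambda> 1\<close> with a new unit \<open>1\<close>.\<close>

datatype 'a unitization = Unz (unz_elem: 'a) (unz_scal: complex)

definition unz_op :: "'a::cstar_algebra unitization \<Rightarrow> 'a \<Rightarrow> 'a"
  where "unz_op u x = unz_elem u * x + unz_scal u *\<^sub>C x"

lemma bounded_linear_unz_op: "bounded_linear (unz_op u)"
proof (rule bounded_linear_intro[where K = "norm (unz_elem u) + cmod (unz_scal u)"])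
  fix x y :: 'a and r :: real
  show "unz_op u (x + y) = unz_op u x + unz_op u y"
    by (simp add: unz_op_def algebra_simps scaleC_add_right)
  show "unz_op u (r *\<^sub>R x) = r *\<^sub>R unz_op u x"
    by (simp add: unz_op_def scaleR_conv_scaleC mult_scaleC_right scaleC_add_right
        scaleC_scaleC mult.commute)
  have "norm (unz_op u x) \<le> norm (unz_elem u * x) + norm (unz_scal u *\<^sub>C x)"
    unfolding unz_op_def by (rule norm_triangle_ineq)
  also have "\<dots> \<le> norm (unz_elem u) * norm x + cmod (unz_scal u) * norm x"
    by (simp add: norm_scaleC norm_mult_ineq)
  finally show "norm (unz_op u x) \<le> norm x * (norm (unz_elem u) + cmod (unz_scal u))"
    by (simp add: algebra_simps)
qed

lemma norm_unz_elem_le: "norm (unz_elem u) \<le> onorm (unz_op u) + cmod (unz_scal u)"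
proof (cases "unz_elem u = 0")
  case True
  then show ?thesis using onorm_pos_le[OF bounded_linear_unz_op, of u] by simp
next
  case False
  let ?a = "unz_elem u"
  have "norm ?a * norm ?a = norm (?a * star ?a)"
    using cstar_identity[of "star ?a"] by (simp add: star_star power2_eq_square)
  also have "?a * star ?a = unz_op u (star ?a) - unz_scal u *\<^sub>C star ?a"
    by (simp add: unz_op_def)
  also have "norm \<dots> \<le> norm (unz_op u (star ?a)) + norm (unz_scal u *\<^sub>C star ?a)"
    by (rule norm_triangle_ineq4)
  also have "\<dots> \<le> onorm (unz_op u) * norm ?a + cmod (unz_scal u) * norm ?a"
    using onorm[OF bounded_linear_unz_op, of u "star ?a"] by (simp add: norm_scaleC)
  finally have "norm ?a * norm ?a \<le> (onorm (unz_op u) + cmod (unz_scal u)) * norm ?a"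
    by (simp add: algebra_simps)
  then show ?thesis using False by simp
qed

instantiation unitization :: (cstar_algebra) real_vector
begin

definition "0 = Unz 0 0"
definition "u + v = Unz (unz_elem u + unz_elem v) (unz_scal u + unz_scal v)"
definition "- u = Unz (- unz_elem u) (- unz_scal u)"
definition "u - v = Unz (unz_elem u - unz_elem v) (unz_scal u - unz_scal v)"
definition "r *\<^sub>R u = Unz (r *\<^sub>R unz_elem u) (r *\<^sub>R unz_scal u)"

instance
proof
  fix u v w :: "'a unitization" and r s :: real
  note defs = zero_unitization_def plus_unitization_def uminus_unitization_def
    minus_unitization_def scaleR_unitization_def
  show "u + v + w = u + (v + w)" "u + v = v + u" "0 + u = u" "- u + u = 0" "u - v = u + - v"
    by (simp_all add: defs algebra_simps)
  show "r *\<^sub>R (u + v) = r *\<^sub>R u + r *\<^sub>R v" "(r + s) *\<^sub>R u = r *\<^sub>R u + s *\<^sub>R u"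
    "r *\<^sub>R s *\<^sub>R u = (r * s) *\<^sub>R u" "1 *\<^sub>R u = u"
    by (simp_all add: defs algebra_simps)
qed

end

text \<open>The norm is the operator norm of \<open>x \<mapsto> a x + \<lambda> x\<close> on the algebra
  whenever the latter is not unital (lemma \<open>norm_unz_nonunital\<close> below), which is the only
  case in which the type \<open>'a unitization\<close> is used for the minimal unitization.
  The maximum with \<open>\<bar>\<lambda>\<bar>\<close> has
  an effect only in the unital case, where it makes the type a C*-algebra nevertheless.\<close>

instantiation unitization :: (cstar_algebra) real_normed_vector
begin

definition "norm u = max (onorm (unz_op u)) (cmod (unz_scal u))"
definition "sgn u = inverse (norm u) *\<^sub>R u" for u :: "'a unitization"
definition "dist u v = norm (u - v)" for u v :: "'a unitization"
definition uniformity_unitization_def [code del]: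
  "uniformity = (INF e\<in>{0 <..}. principal {(x::'a unitization, y). dist x y < e})"
definition open_unitization_def [code del]:
  "open (U :: 'a unitization set) \<longleftrightarrow>
     (\<forall>x\<in>U. eventually (\<lambda>(x', y). x' = x \<longrightarrow> y \<in> U) uniformity)"

instance
proof
  fix u v :: "'a unitization" and r :: real
  have op_add: "unz_op (u + v) = (\<lambda>x. unz_op u x + unz_op v x)" for u v :: "'a unitization"
    by (auto simp: unz_op_def plus_unitization_def algebra_simps)
  show "dist u v = norm (u - v)" "sgn u = u /\<^sub>R norm u"
    by (simp_all add: dist_unitization_def sgn_unitization_def)
  show "uniformity = (INF e\<in>{0 <..}. principal {(x::'a unitization, y). dist x y < e})"
    by (rule uniformity_unitization_def)
  show "open U \<longleftrightarrow> (\<forall>x\<in>U. \<forall>\<^sub>F (x', y) in uniformity. x' = x \<longrightarrow> y \<in> U)"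
    for U :: "'a unitization set"
    by (rule open_unitization_def)
  show "norm u = 0 \<longleftrightarrow> u = 0"
  proof
    assume "norm u = 0"
    then have "onorm (unz_op u) \<le> 0" "cmod (unz_scal u) \<le> 0"
      by (metis max.cobounded1 max.cobounded2 norm_unitization_def)+
    then have "cmod (unz_scal u) = 0" "norm (unz_elem u) = 0"
      using norm_unz_elem_le[of u] norm_ge_zero[of "unz_elem u"] norm_ge_zero[of "unz_scal u"] by linarith+
    then show "u = 0" by (cases u) (simp add: zero_unitization_def)
  next
    assume "u = 0"
    then show "norm u = 0"
      by (simp add: norm_unitization_def unz_op_def[abs_def] zero_unitization_def onorm_zero)
  qed
  have "onorm (unz_op (u + v)) \<le> onorm (unz_op u) + onorm (unz_op v)"
    unfolding op_add by (rule onorm_triangle[OF bounded_linear_unz_op bounded_linear_unz_op])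
  moreover have "cmod (unz_scal (u + v)) \<le> cmod (unz_scal u) + cmod (unz_scal v)"
    by (simp add: plus_unitization_def norm_triangle_ineq)
  ultimately show "norm (u + v) \<le> norm u + norm v"
    unfolding norm_unitization_def by linarith
  have op_scaleR: "unz_op (r *\<^sub>R u) = (\<lambda>x. r *\<^sub>R unz_op u x)"
    by (rule ext) (simp add: unz_op_def scaleR_unitization_def scaleR_conv_scaleC
        scaleR_conv_of_real mult_scaleC_left scaleC_add_right scaleC_scaleC)
  show "norm (r *\<^sub>R u) = \<bar>r\<bar> * norm u"
    by (simp add: norm_unitization_def op_scaleR onorm_scaleR[OF bounded_linear_unz_op]
        max_mult_distrib_left) (simp add: scaleR_unitization_def)
qed

end

instantiation unitization :: (cstar_algebra) cstar_algebra
begin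

definition "u * v = Unz (unz_elem u * unz_elem v + unz_scal v *\<^sub>C unz_elem u
  + unz_scal u *\<^sub>C unz_elem v) (unz_scal u * unz_scal v)"
definition "c *\<^sub>C u = Unz (c *\<^sub>C unz_elem u) (c * unz_scal u)"
definition "star u = Unz (star (unz_elem u)) (cnj (unz_scal u))"

instance
proof
  fix u v w :: "'a unitization" and c d :: complex and r s :: real
  note defs = zero_unitization_def plus_unitization_def uminus_unitization_def
    minus_unitization_def times_unitization_def scaleC_unitization_def
    scaleR_unitization_def star_unitization_def
  have op_scaleC: "unz_op (c *\<^sub>C u) = (\<lambda>x. c *\<^sub>C unz_op u x)" for c and u :: "'a unitization"
    by (auto simp: unz_op_def defs algebra_simps mult_scaleC_left)
  have op_mult: "unz_op (u * v) = unz_op u \<circ> unz_op v" for u v :: "'a unitization"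
    by (auto simp: unz_op_def defs algebra_simps mult_scaleC_left mult_scaleC_right fun_eq_iff)
  show "u * v * w = u * (v * w)"
    by (simp add: defs algebra_simps mult_scaleC_left mult_scaleC_right)
  show "(u + v) * w = u * w + v * w" "u * (v + w) = u * v + u * w"
    by (simp_all add: defs algebra_simps)
  show "r *\<^sub>R u * v = r *\<^sub>R (u * v)" "u * r *\<^sub>R v = r *\<^sub>R (u * v)"
    by (simp_all add: defs algebra_simps scaleR_conv_scaleC scaleR_conv_of_real mult_scaleC_left mult_scaleC_right)
  have onorm_sC_le: "onorm (unz_op (c *\<^sub>C u)) \<le> cmod c * onorm (unz_op u)" for c and u :: "'a unitization"
  proof (rule onorm_bound)
    fix x :: 'a
    show "norm (unz_op (c *\<^sub>C u) x) \<le> cmod c * onorm (unz_op u) * norm x"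
      using mult_left_mono[OF onorm[OF bounded_linear_unz_op, of u x], of "cmod c"]
      by (simp add: op_scaleC norm_scaleC mult.assoc)
  qed (simp_all add: onorm_pos_le[OF bounded_linear_unz_op])
  have norm_sC_le: "norm (c *\<^sub>C u) \<le> cmod c * norm u" for c and u :: "'a unitization"
  proof -
    have "cmod (unz_scal (c *\<^sub>C u)) = cmod c * cmod (unz_scal u)"
      by (simp add: scaleC_unitization_def norm_mult)
    then show ?thesis
      using onorm_sC_le[of c u] unfolding norm_unitization_def
      by (simp add: max_mult_distrib_left)
  qed
  show norm_sC: "norm (c *\<^sub>C u) = cmod c * norm u" for c and u :: "'a unitization"
  proof (cases "c = 0")
    case True
    then show ?thesis
      using norm_sC_le[of c u] onorm_pos_le[OF bounded_linear_unz_op, of "c *\<^sub>C u"]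
      by (simp add: norm_unitization_def)
  next
    case False
    have "u = inverse c *\<^sub>C (c *\<^sub>C u)"
      using False by (cases u) (simp add: scaleC_unitization_def)
    then have "norm u \<le> inverse (cmod c) * norm (c *\<^sub>C u)"
      using norm_sC_le[of "inverse c" "c *\<^sub>C u"] by (simp add: norm_inverse)
    then have "cmod c * norm u \<le> norm (c *\<^sub>C u)"
      using False by (simp add: field_simps)
    then show ?thesis using norm_sC_le[of c u] by simp
  qed
  show sRC: "r *\<^sub>R u = complex_of_real r *\<^sub>C u" for r and u :: "'a unitization"
    by (simp add: defs scaleR_conv_scaleC scaleR_conv_of_real)
  have "onorm (unz_op (u * v)) \<le> onorm (unz_op u) * onorm (unz_op v)" for u v :: "'a unitization"
    unfolding op_mult by (rule onorm_compose[OF bounded_linear_unz_op bounded_linear_unz_op])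
  note op_mult_le = this
  show "norm (u * v) \<le> norm u * norm v"
  proof -
    have "cmod (unz_scal (u * v)) = cmod (unz_scal u) * cmod (unz_scal v)"
      by (simp add: times_unitization_def norm_mult)
    moreover have "cmod (unz_scal u) * cmod (unz_scal v) \<le> norm u * norm v"
      by (rule mult_mono) (auto simp: norm_unitization_def le_max_iff_disj)
    moreover have "onorm (unz_op u) * onorm (unz_op v) \<le> norm u * norm v"
      by (rule mult_mono)
        (auto simp: norm_unitization_def le_max_iff_disj onorm_pos_le[OF bounded_linear_unz_op])
    ultimately show ?thesis
      using op_mult_le[of u v] unfolding norm_unitization_def[of "u * v"] by simp
  qed
  show "c *\<^sub>C (u + v) = c *\<^sub>C u + c *\<^sub>C v" "(c + d) *\<^sub>C u = c *\<^sub>C u + d *\<^sub>C u"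
    "c *\<^sub>C d *\<^sub>C u = (c * d) *\<^sub>C u" "1 *\<^sub>C u = u"
    by (simp_all add: defs algebra_simps)
  show "c *\<^sub>C u * v = c *\<^sub>C (u * v)" "u * c *\<^sub>C v = c *\<^sub>C (u * v)"
    by (simp_all add: defs algebra_simps mult_scaleC_left mult_scaleC_right)
  show "star (u + v) = star u + star v" "star (c *\<^sub>C u) = cnj c *\<^sub>C star u"
    "star (u * v) = star v * star u" "star (star u) = u"
    by (simp_all add: defs star_add star_scaleC star_mult star_star algebra_simps)
  have adj: "star (unz_op u x) * unz_op u x = star x * unz_op (star u * u) x"
    for u :: "'a unitization" and x
    by (simp add: unz_op_def defs star_add star_scaleC star_mult star_star algebra_simps
        mult_scaleC_left mult_scaleC_right)
  have op_sq_le: "(onorm (unz_op u))\<^sup>2 \<le> onorm (unz_op (star u * u))" for u :: "'a unitization"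
  proof -
    let ?M = "onorm (unz_op (star u * u))"
    have M0: "?M \<ge> 0" by (rule onorm_pos_le[OF bounded_linear_unz_op])
    have "onorm (unz_op u) \<le> sqrt ?M"
    proof (rule onorm_bound)
      fix x :: 'a
      have "(norm (unz_op u x))\<^sup>2 = norm (star x * unz_op (star u * u) x)"
        by (simp add: cstar_identity flip: adj)
      also have "\<dots> \<le> norm x * norm (unz_op (star u * u) x)"
        using norm_mult_ineq[of "star x"] by simp
      also have "\<dots> \<le> norm x * (?M * norm x)"
        by (intro mult_left_mono onorm[OF bounded_linear_unz_op]) simp
      also have "\<dots> = (sqrt ?M * norm x)\<^sup>2"
        using M0 by (simp add: power_mult_distrib power2_eq_square mult_ac)
      finally show "norm (unz_op u x) \<le> sqrt ?M * norm x"
        by (rule power2_le_imp_le) (simp add: M0)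
    qed (simp_all add: onorm_pos_le[OF bounded_linear_unz_op])
    then have "(onorm (unz_op u))\<^sup>2 \<le> (sqrt ?M)\<^sup>2"
      by (intro power_mono onorm_pos_le[OF bounded_linear_unz_op])
    then show ?thesis using M0 by simp
  qed
  have op_star_le: "onorm (unz_op u) \<le> onorm (unz_op (star u))" for u :: "'a unitization"
  proof (cases "onorm (unz_op u) = 0")
    case True
    then show ?thesis using onorm_pos_le[OF bounded_linear_unz_op] by simp
  next
    case False
    then have pos: "onorm (unz_op u) > 0"
      using onorm_pos_le[OF bounded_linear_unz_op, of u] by simp
    have "onorm (unz_op u) * onorm (unz_op u) \<le> onorm (unz_op (star u)) * onorm (unz_op u)"
      using op_sq_le[of u] op_mult_le[of "star u" u] by (simp add: power2_eq_square)
    then show ?thesis using pos by simp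
  qed
  have "onorm (unz_op (star u)) \<le> onorm (unz_op u)"
    using op_star_le[of "star u"] by (simp add: star_unitization_def star_star)
  then have "onorm (unz_op (star u * u)) \<le> (onorm (unz_op u))\<^sup>2"
    using op_mult_le[of "star u" u]
      mult_right_mono[of "onorm (unz_op (star u))" "onorm (unz_op u)" "onorm (unz_op u)"]
      onorm_pos_le[OF bounded_linear_unz_op, of u]
    by (simp add: power2_eq_square)
  then have op_sq: "onorm (unz_op (star u * u)) = (onorm (unz_op u))\<^sup>2"
    using op_sq_le[of u] by simp
  have scal_sq: "cmod (unz_scal (star u * u)) = (cmod (unz_scal u))\<^sup>2"
    by (simp add: star_unitization_def times_unitization_def norm_mult power2_eq_square)
  show "norm (star u * u) = (norm u)\<^sup>2"
  proof (cases "onorm (unz_op u) \<le> cmod (unz_scal u)")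
    case True
    then have "(onorm (unz_op u))\<^sup>2 \<le> (cmod (unz_scal u))\<^sup>2"
      by (intro power_mono onorm_pos_le[OF bounded_linear_unz_op])
    then show ?thesis using True by (simp add: norm_unitization_def op_sq scal_sq)
  next
    case False
    then have "(cmod (unz_scal u))\<^sup>2 \<le> (onorm (unz_op u))\<^sup>2"
      by (intro power_mono) auto
    then show ?thesis using False by (simp add: norm_unitization_def op_sq scal_sq)
  qed
next
  fix X :: "nat \<Rightarrow> 'a unitization"
  assume "Cauchy X"
  have scal_le: "cmod (unz_scal u) \<le> norm u" for u :: "'a unitization"
    by (simp add: norm_unitization_def)
  have elem_le: "norm (unz_elem u) \<le> 2 * norm u" for u :: "'a unitization"
    using norm_unz_elem_le[of u] unfolding norm_unitization_def by linarith
  have norm_le: "norm u \<le> norm (unz_elem u) + cmod (unz_scal u)" for u :: "'a unitization"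
  proof -
    have "onorm (unz_op u) \<le> norm (unz_elem u) + cmod (unz_scal u)"
    proof (rule onorm_bound)
      fix x :: 'a
      show "norm (unz_op u x) \<le> (norm (unz_elem u) + cmod (unz_scal u)) * norm x"
        using norm_triangle_ineq[of "unz_elem u * x" "unz_scal u *\<^sub>C x"]
          norm_mult_ineq[of "unz_elem u" x]
        by (simp add: unz_op_def norm_scaleC algebra_simps)
    qed (simp_all add: onorm_pos_le[OF bounded_linear_unz_op])
    then show ?thesis by (simp add: norm_unitization_def)
  qed
  have "Cauchy (\<lambda>n. unz_scal (X n))"
  proof (rule metric_CauchyI)
    fix e :: real assume "e > 0"
    then obtain M where M: "\<And>m n. m \<ge> M \<Longrightarrow> n \<ge> M \<Longrightarrow> dist (X m) (X n) < e"
      using \<open>Cauchy X\<close> by (meson Cauchy_def)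
    have "dist (unz_scal (X m)) (unz_scal (X n)) < e" if "m \<ge> M" "n \<ge> M" for m n
      using M[OF that] scal_le[of "X m - X n"]
      by (simp add: dist_norm minus_unitization_def)
    then show "\<exists>M. \<forall>m\<ge>M. \<forall>n\<ge>M. dist (unz_scal (X m)) (unz_scal (X n)) < e" by blast
  qed
  then obtain l where l: "(\<lambda>n. unz_scal (X n)) \<longlonglongrightarrow> l"
    using Cauchy_convergent_iff convergent_def by blast
  have "Cauchy (\<lambda>n. unz_elem (X n))"
  proof (rule metric_CauchyI)
    fix e :: real assume "e > 0"
    then have "e / 2 > 0" by simp
    then obtain M where M: "\<And>m n. m \<ge> M \<Longrightarrow> n \<ge> M \<Longrightarrow> dist (X m) (X n) < e / 2"
      using \<open>Cauchy X\<close> by (meson Cauchy_def)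
    have "dist (unz_elem (X m)) (unz_elem (X n)) < e" if "m \<ge> M" "n \<ge> M" for m n
      using M[OF that] elem_le[of "X m - X n"]
      by (simp add: dist_norm minus_unitization_def)
    then show "\<exists>M. \<forall>m\<ge>M. \<forall>n\<ge>M. dist (unz_elem (X m)) (unz_elem (X n)) < e" by blast
  qed
  then obtain a where a: "(\<lambda>n. unz_elem (X n)) \<longlonglongrightarrow> a"
    using Cauchy_convergent_iff convergent_def by blast
  have "\<exists>M. \<forall>n\<ge>M. dist (X n) (Unz a l) < e" if "e > 0" for e
  proof -
    have "(\<lambda>n. norm (unz_elem (X n) - a) + cmod (unz_scal (X n) - l)) \<longlonglongrightarrow> 0"
      using tendsto_add[OF tendsto_norm_zero[OF LIM_zero[OF a]] tendsto_norm_zero[OF LIM_zero[OF l]]]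
      by simp
    then obtain M where M: "\<And>n. n \<ge> M \<Longrightarrow> norm (unz_elem (X n) - a) + cmod (unz_scal (X n) - l) < e"
      using \<open>e > 0\<close> by (force dest!: order_tendstoD(2)[where a = e] simp: eventually_sequentially)
    have "dist (X n) (Unz a l) < e" if "n \<ge> M" for n
      using M[OF that] norm_le[of "X n - Unz a l"]
      by (simp add: dist_norm minus_unitization_def)
    then show ?thesis by blast
  qed
  then have "X \<longlonglongrightarrow> Unz a l"
    by (simp add: LIMSEQ_def)
  then show "convergent X" by (auto simp: convergent_def)
qed

end

lemma norm_unz_nonunital:
  assumes "\<not> unital TYPE('a::cstar_algebra)"
  shows "norm (Unz (a::'a) l) = onorm (\<lambda>x. a * x + l *\<^sub>C x)"
proof -
  define r where "r = onorm (unz_op (Unz a l))"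
  have r0: "r \<ge> 0" unfolding r_def by (rule onorm_pos_le[OF bounded_linear_unz_op])
  have "cmod l \<le> r"
  proof (rule ccontr)
    assume "\<not> cmod l \<le> r"
    then have lr: "r < cmod l" and l0: "l \<noteq> 0" using r0 by auto
    define b where "b = (- inverse l) *\<^sub>C a"
    define q where "q = r / cmod l"
    have q: "0 \<le> q" "q < 1" using lr r0 by (auto simp: q_def divide_simps)
    have contr: "norm (x - b * x) \<le> q * norm x" for x
    proof -
      have "x - b * x = inverse l *\<^sub>C unz_op (Unz a l) x"
        using l0 by (simp add: b_def unz_op_def scaleC_add_right scaleC_scaleC scaleC_one
            mult_scaleC_left cvec.scale_minus_left)
      then have "norm (x - b * x) = norm (unz_op (Unz a l) x) / cmod l"
        by (simp add: norm_scaleC norm_inverse divide_inverse_commute)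
      also have "\<dots> \<le> r * norm x / cmod l"
        unfolding r_def by (intro divide_right_mono onorm[OF bounded_linear_unz_op]) simp
      finally show ?thesis by (simp add: q_def)
    qed
    have "\<exists>!e\<in>UNIV. e + b - b * e = e"
    proof (rule Banach_fix[of UNIV q])
      show "\<And>x y. dist (x + b - b * x) (y + b - b * y) \<le> q * dist x y"
        using contr[of "x - y" for x y] by (simp add: dist_norm algebra_simps)
    qed (use q in \<open>auto simp: complete_UNIV\<close>)
    then obtain e where "e + b - b * e = e" by blast
    then have be: "b * e = b" by (simp add: algebra_simps)
    have left: "e * x = x" for x
    proof -
      have "b * (e * x - x) = 0" by (simp add: right_diff_distrib be flip: mult.assoc)
      then have "norm (e * x - x) \<le> q * norm (e * x - x)" using contr[of "e * x - x"] by simp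
      then have "(1 - q) * norm (e * x - x) \<le> 0" by (simp add: algebra_simps)
      then have "norm (e * x - x) \<le> 0" using q by (simp add: mult_le_0_iff)
      then show ?thesis by simp
    qed
    have right: "x * star e = x" for x
      using left[of "star x"] by (metis star_mult star_star)
    have "star e = e" using left[of "star e"] right[of e] by simp
    then have "unital TYPE('a)" using left right by (auto simp: unital_def)
    with assms show False ..
  qed
  then show ?thesis
    by (simp add: norm_unitization_def r_def unz_op_def[abs_def])
qed

section \<open>Generator rank\<close>

definition gr0_le :: "'a::cstar_algebra itself \<Rightarrow> nat \<Rightarrow> bool"
  where "gr0_le _ n \<longleftrightarrow>
    (\<forall>(a::nat \<Rightarrow> 'a) \<epsilon> c. (\<forall>j\<le>n. selfadjoint (a j)) \<longrightarrow> \<epsilon> > 0 \<longrightarrow>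
       (\<exists>b. (\<forall>j\<le>n. selfadjoint (b j) \<and> norm (b j - a j) < \<epsilon>) \<and>
            approx_in \<epsilon> c (cstar_generated (b ` {..n}))))"

definition gr0 :: "'a::cstar_algebra itself \<Rightarrow> enat"
  where "gr0 A = (if \<exists>n. gr0_le A n then enat (LEAST n. gr0_le A n) else \<infinity>)"

text \<open>The minimal unitization of a unital algebra is the algebra itself.\<close>

definition gr :: "'a::cstar_algebra itself \<Rightarrow> enat"
  where "gr A = (if unital A then gr0 A else gr0 TYPE('a unitization))"

end

theory Submission
  imports Defs "HOL-Computational_Algebra.Fundamental_Theorem_Algebra"
begin

text \<open>Let \<open>B\<close> be a finite-dimensional C*-algebra and \<open>a0, a1\<close> self-adjoint elements of it. Among the
  families of nonzero orthogonal projections \<open>p\<close> with \<open>a0 p \<in> \<complex> p\<close> take a largest one. Then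
  \<open>a0\<close> is a combination of the \<open>p\<close>, the family sums to the unit of \<open>B\<close>, each corner \<open>p B p\<close> is
  \<open>\<complex> p\<close>, and hence each \<open>p B q\<close> has dimension at most one. Perturb the eigenvalues of \<open>a0\<close> to be
  distinct and nonzero, so that \<open>b0\<close> generates all \<open>p\<close>, and perturb \<open>a1\<close> so that \<open>p b1 q \<noteq> 0\<close>
  whenever \<open>p B q \<noteq> 0\<close>; then \<open>b0\<close> and \<open>b1\<close> generate \<open>B\<close>. This replaces the structure theorem for
  finite-dimensional C*-algebras. For a locally finite-dimensional algebra it follows that for each
  \<open>c\<close> and \<open>\<epsilon>\<close> the set of all \<open>a\<close> with \<open>c \<in>\<^sub>\<epsilon> C*(a)\<close> is dense; it is also open, and Baire's theorem
  applies.\<close>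

section \<open>Finite-dimensional star-subalgebras\<close>

definition star_subalgebra :: "'a::cstar_algebra set \<Rightarrow> bool"
  where "star_subalgebra S \<longleftrightarrow> cvec.subspace S \<and> (\<forall>x\<in>S. \<forall>y\<in>S. x * y \<in> S) \<and> (\<forall>x\<in>S. star x \<in> S)"

lemma sub_cstar_iff: "sub_cstar S \<longleftrightarrow> star_subalgebra S \<and> closed S"
  by (auto simp: sub_cstar_def star_subalgebra_def)

lemma star_subalgebraD:
  assumes "star_subalgebra S"
  shows "cvec.subspace S" "0 \<in> S" "x \<in> S \<Longrightarrow> y \<in> S \<Longrightarrow> x + y \<in> S"
    "x \<in> S \<Longrightarrow> y \<in> S \<Longrightarrow> x - y \<in> S" "x \<in> S \<Longrightarrow> c *\<^sub>C x \<in> S"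
    "x \<in> S \<Longrightarrow> y \<in> S \<Longrightarrow> x * y \<in> S" "x \<in> S \<Longrightarrow> star x \<in> S"
  using assms by (auto simp: star_subalgebra_def cvec.subspace_0 cvec.subspace_add
      cvec.subspace_diff cvec.subspace_scale)

lemma star_diff: "star (x - y) = star x - star (y::'a::cstar_algebra)"
  by (metis star_add star_minus diff_conv_add_uminus)

lemma star_sum: "star (sum f A) = (\<Sum>i\<in>A. star (f i :: 'a::cstar_algebra))"
  by (induction A rule: infinite_finite_induct) (auto simp: star_add)

lemma star_mult_self_eq_0_iff [simp]: "star x * x = 0 \<longleftrightarrow> x = (0::'a::cstar_algebra)"
  by (metis cstar_identity mult_zero_right norm_eq_zero power_not_zero)

lemma mult_star_self_eq_0_iff [simp]: "x * star x = 0 \<longleftrightarrow> x = (0::'a::cstar_algebra)"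
  by (metis star_mult_self_eq_0_iff star_star star_zero)

lemma square_eq_0_iff_selfadjoint:
  "selfadjoint x \<Longrightarrow> x * x = 0 \<longleftrightarrow> x = (0::'a::cstar_algebra)"
  by (metis selfadjoint_def star_mult_self_eq_0_iff)

section \<open>Self-adjoint parts, and polynomials in one element\<close>

definition re_part :: "'a::cstar_algebra \<Rightarrow> 'a"
  where "re_part x = (1/2) *\<^sub>C (x + star x)"

definition im_part :: "'a::cstar_algebra \<Rightarrow> 'a"
  where "im_part x = (- \<i>/2) *\<^sub>C (x - star x)"

lemma selfadjoint_re_part [simp]: "selfadjoint (re_part x)"
  by (simp add: selfadjoint_def re_part_def star_scaleC star_add star_star add.commute)

lemma selfadjoint_im_part [simp]: "selfadjoint (im_part x)"
proof -
  have "(- \<i>/2) *\<^sub>C (x - star x) = (\<i>/2) *\<^sub>C (star x - x)"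
    by (simp add: cvec.scale_minus_left cvec.scale_right_diff_distrib)
  then show ?thesis
    by (simp add: selfadjoint_def im_part_def star_scaleC star_diff star_star)
qed

lemma re_part_plus_im_part: "re_part x + \<i> *\<^sub>C im_part x = x"
proof -
  have "re_part x + \<i> *\<^sub>C im_part x = (1/2) *\<^sub>C x + (1/2) *\<^sub>C x"
    by (simp add: re_part_def im_part_def scaleC_scaleC scaleC_add_right cvec.scale_right_diff_distrib)
  also have "\<dots> = x" by (simp add: scaleC_one flip: scaleC_add_left)
  finally show ?thesis .
qed

lemma re_part_combination:
  assumes "selfadjoint a" "selfadjoint b"
  shows "re_part (a + \<i> *\<^sub>C b) = a" "im_part (a + \<i> *\<^sub>C b) = b"
proof -
  have *: "star (a + \<i> *\<^sub>C b) = a - \<i> *\<^sub>C b"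
    using assms by (simp add: selfadjoint_def star_add star_scaleC cvec.scale_minus_left)
  have d: "(1/2) *\<^sub>C (x + x) = x" for x :: 'a
    by (simp add: scaleC_add_right scaleC_one flip: scaleC_add_left)
  show "re_part (a + \<i> *\<^sub>C b) = a"
    using d[of a] by (simp add: re_part_def *)
  show "im_part (a + \<i> *\<^sub>C b) = b"
    using d[of b] by (simp add: im_part_def * scaleC_add_right scaleC_scaleC)
qed

lemma re_im_part_closed:
  assumes "star_subalgebra S" "x \<in> S"
  shows "re_part x \<in> S" "im_part x \<in> S"
  unfolding re_part_def im_part_def using assms by (intro star_subalgebraD; simp)+

lemma norm_re_part_le: "norm (re_part x) \<le> norm x"
  using norm_triangle_ineq[of x "star x"] by (simp add: re_part_def norm_scaleC)

lemma re_part_diff: "re_part (x - y) = re_part x - re_part y"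
  by (simp add: re_part_def star_diff scaleC_add_right cvec.scale_right_diff_distrib)

text \<open>As the algebra need not have a unit, \<open>poly_mult p x\<close> is \<open>p(x) x\<close>.\<close>

definition poly_mult :: "complex poly \<Rightarrow> 'a::cstar_algebra \<Rightarrow> 'a"
  where "poly_mult p x = fold_coeffs (\<lambda>c y. c *\<^sub>C x + x * y) p 0"

lemma poly_mult_0 [simp]: "poly_mult 0 x = 0"
  by (simp add: poly_mult_def)

lemma poly_mult_pCons [simp]: "poly_mult (pCons c p) x = c *\<^sub>C x + x * poly_mult p x"
  by (cases "p = 0 \<and> c = 0") (auto simp: poly_mult_def)

lemma poly_mult_add: "poly_mult (p + q) x = poly_mult p x + poly_mult q x"
  by (induction p q rule: poly_induct2) (simp_all add: algebra_simps scaleC_add_left)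

lemma poly_mult_smult: "poly_mult (smult c p) x = c *\<^sub>C poly_mult p x"
  by (induction p) (simp_all add: scaleC_add_right scaleC_scaleC mult_scaleC_right)

lemma poly_mult_sum: "poly_mult (sum f A) x = (\<Sum>i\<in>A. poly_mult (f i) x)"
  by (induction A rule: infinite_finite_induct) (auto simp: poly_mult_add)

lemma poly_mult_closed: "star_subalgebra S \<Longrightarrow> x \<in> S \<Longrightarrow> poly_mult p x \<in> S"
  by (induction p) (auto intro!: star_subalgebraD)

lemma poly_mult_commute:
  "x * y = y * x \<Longrightarrow> y * poly_mult p x = poly_mult p x * y"
  by (induction p) (simp_all add: algebra_simps mult_scaleC_left mult_scaleC_right, metis mult.assoc)

text \<open>\<open>poly_mult p x\<close> is \<open>p(x) x\<close>, and the trailing \<open>x\<close>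
  contributes the extra factor \<open>l\<close>. This factor later makes the eigenvalue of a
  projection nonzero.\<close>

lemma poly_mult_eigenvector:
  assumes "x * z = l *\<^sub>C z"
  shows "poly_mult p x * z = (l * poly p l) *\<^sub>C z"
proof (induction p)
  case (pCons c p)
  have "poly_mult (pCons c p) x * z = c *\<^sub>C (x * z) + x * (poly_mult p x * z)"
    by (simp add: distrib_right mult_scaleC_left mult.assoc)
  also have "\<dots> = (c * l + l * poly p l * l) *\<^sub>C z"
    by (simp add: pCons.IH assms mult_scaleC_right scaleC_scaleC scaleC_add_left)
  also have "c * l + l * poly p l * l = l * poly (pCons c p) l"
    by (simp add: algebra_simps)
  finally show ?case .
qed simp

lemma star_poly_mult:
  assumes "selfadjoint x"
  shows "star (poly_mult p x) = poly_mult (map_poly cnj p) x"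
proof (induction p)
  case (pCons c p)
  have "x * poly_mult (map_poly cnj p) x = poly_mult (map_poly cnj p) x * x"
    by (rule poly_mult_commute) simp
  with pCons assms show ?case
    by (simp add: map_poly_pCons star_add star_scaleC star_mult selfadjoint_def)
qed simp

lemma poly_mult_monom: "poly_mult (monom c n) x = c *\<^sub>C ((\<lambda>y. x * y) ^^ n) x"
  by (induction n) (simp_all add: monom_0 monom_Suc mult_scaleC_right)

text \<open>\<open>B\<close> is spanned by \<open>card X\<close> elements, so the
  \<open>card X + 1\<close> powers \<open>pw n\<close>, the (n+1)-st powers of \<open>x\<close>,
  satisfy a linear relation. Its coefficients form \<open>p\<close>.\<close>

lemma poly_mult_annihilated:
  assumes "fin_dim B" "star_subalgebra B" "x \<in> B"
  shows "\<exists>p. p \<noteq> 0 \<and> poly_mult p x = 0"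
proof -
  obtain X where X: "finite X" "cvec.span X = B"
    using assms by (auto simp: fin_dim_def)
  define pw where "pw n = ((\<lambda>y. x * y) ^^ n) x" for n
  define T where "T = {..card X}"
  have pw_in: "pw n \<in> B" for n
    by (induction n) (use assms in \<open>auto simp: pw_def intro: star_subalgebraD\<close>)
  show ?thesis
  \<comment> \<open>Linear dependence is a property of the set of powers, which does not see
    repetitions. Two equal powers therefore form a case of their own, with the difference of two
    monomials as \<open>p\<close>.\<close>
  proof (cases "inj_on pw T")
    case True
    have "cvec.dependent (pw ` T)"
    proof (rule ccontr)
      assume "cvec.independent (pw ` T)"
      from cvec.independent_span_bound[OF X(1) this] X pw_in
      have "card (pw ` T) \<le> card X" by auto
      then show False using card_image[OF True] by (simp add: T_def)
    qed
    then obtain u where u: "\<exists>v\<in>pw ` T. u v \<noteq> 0" "(\<Sum>v\<in>pw ` T. u v *\<^sub>C v) = 0"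
      by (subst (asm) cvec.dependent_finite) (auto simp: T_def)
    from u(1) obtain n where n: "n \<in> T" "u (pw n) \<noteq> 0" by blast
    define p where "p = (\<Sum>i\<in>T. monom (u (pw i)) i)"
    have "poly_mult p x = 0"
      using u(2) True by (simp add: p_def poly_mult_sum poly_mult_monom sum.reindex flip: pw_def)
    moreover have "coeff p n \<noteq> 0"
      using n by (simp add: p_def coeff_sum T_def)
    ultimately show ?thesis by (metis coeff_0)
  next
    case False
    then obtain i j where ij: "i \<noteq> j" "pw i = pw j" by (auto simp: inj_on_def)
    define p where "p = monom (1::complex) i + monom (-1) j"
    have "poly_mult p x = 0"
      using ij by (simp add: p_def poly_mult_add poly_mult_monom scaleC_one flip: pw_def)
    moreover have "coeff p i \<noteq> 0"
      using ij by (simp add: p_def)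
    ultimately show ?thesis by (metis coeff_0)
  qed
qed

section \<open>Projections and families of eigenprojections\<close>

definition projection :: "'a::cstar_algebra \<Rightarrow> bool"
  where "projection p \<longleftrightarrow> selfadjoint p \<and> p * p = p"

text \<open>Divide a nonzero annihilating polynomial of least degree by a linear factor. By
  minimality the quotient \<open>g\<close> gives some \<open>y \<noteq> 0\<close> with
  \<open>x * y = l *\<^sub>C y\<close>. A multiple of \<open>y * star y\<close> is the
  projection.\<close>

lemma eigenprojection_exists:
  fixes x :: "'a::cstar_algebra"
  assumes "fin_dim B" "star_subalgebra B" "x \<in> B" "selfadjoint x" "x \<noteq> 0"
  obtains q and l :: complex where "q \<in> B" "q \<noteq> 0" "projection q" "l \<noteq> 0" "x * q = l *\<^sub>C q"
proof -
  obtain p where p: "p \<noteq> 0" "poly_mult p x = 0"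
    and min: "\<And>q. q \<noteq> 0 \<Longrightarrow> poly_mult q x = 0 \<Longrightarrow> degree p \<le> degree q"
    using poly_mult_annihilated[OF assms(1-3)]
      ex_has_least_nat[of "\<lambda>p. p \<noteq> 0 \<and> poly_mult p x = 0" _ degree] by blast
  have "degree p \<noteq> 0"
  proof
    assume "degree p = 0"
    then obtain c where "p = [:c:]" by (metis degree_eq_zeroE)
    with p \<open>x \<noteq> 0\<close> show False by auto
  qed
  then have "\<not> constant (poly p)" by (simp add: constant_degree)
  then obtain l where "poly p l = 0" using fundamental_theorem_of_algebra by blast
  then obtain g where g: "p = [:- l, 1:] * g" by (auto simp: poly_eq_0_iff_dvd)
  with p(1) have "g \<noteq> 0" by auto
  define y where "y = poly_mult g x"
  have "y \<noteq> 0"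
  proof
    assume "y = 0"
    with min \<open>g \<noteq> 0\<close> have "degree p \<le> degree g" by (auto simp: y_def)
    moreover have "degree p = 1 + degree g"
      using \<open>g \<noteq> 0\<close> unfolding g by (subst degree_mult_eq) auto
    ultimately show False by simp
  qed
  have xy: "x * y = l *\<^sub>C y"
  proof -
    have "p = smult (- l) g + pCons 0 g" by (simp add: g)
    then have "poly_mult p x = poly_mult (smult (- l) g + pCons 0 g) x" by (rule arg_cong)
    also have "\<dots> = (- l) *\<^sub>C y + x * y"
      by (simp only: poly_mult_add poly_mult_smult poly_mult_pCons y_def) simp
    finally have "poly_mult p x = (- l) *\<^sub>C y + x * y" .
    then show ?thesis using p(2) by (simp add: cvec.scale_minus_left)
  qed
  have y_in: "y \<in> B"
    unfolding y_def using assms(2,3) by (rule poly_mult_closed)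
  have y_star: "star y = poly_mult (map_poly cnj g) x"
    using assms(4) by (simp add: y_def star_poly_mult)
  \<comment> \<open>At this point \<open>l\<close> may be non-real and \<open>y\<close> not
    self-adjoint; \<open>z\<close> is self-adjoint and still an eigenvector. Both \<open>y\<close>
    and \<open>star y\<close> are polynomials in \<open>x\<close>, so they act on \<open>z\<close>
    as scalars and \<open>z * z\<close> is a multiple of \<open>z\<close>.\<close>
  define z where "z = y * star y"
  have z: "z \<noteq> 0" "star z = z" "x * z = l *\<^sub>C z" "z \<in> B"
    using \<open>y \<noteq> 0\<close> xy y_in assms(2)
    by (auto simp: z_def star_mult star_star intro!: star_subalgebraD(6,7))
      (metis mult.assoc mult_scaleC_left)
  define c where "c = (l * poly (map_poly cnj g) l) * (l * poly g l)"
  have zz: "z * z = c *\<^sub>C z"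
  proof -
    have "star y * z = (l * poly (map_poly cnj g) l) *\<^sub>C z"
      unfolding y_star by (rule poly_mult_eigenvector[OF z(3)])
    moreover have "y * z = (l * poly g l) *\<^sub>C z"
      unfolding y_def by (rule poly_mult_eigenvector[OF z(3)])
    moreover have "z * z = y * (star y * z)"
      by (simp add: z_def mult.assoc)
    ultimately show ?thesis by (simp add: mult_scaleC_right scaleC_scaleC c_def)
  qed
  have "z * z \<noteq> 0"
    using square_eq_0_iff_selfadjoint[of z] z(1,2) by (simp add: selfadjoint_def)
  then have c0: "c \<noteq> 0" by (auto simp: zz)
  have "cnj c *\<^sub>C z = c *\<^sub>C z"
    by (metis star_scaleC star_mult z(2) zz)
  then have c_real: "cnj c = c" using z(1) by simp
  show ?thesis
  proof (rule that[of "inverse c *\<^sub>C z" l])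
    show "inverse c *\<^sub>C z \<in> B" using assms(2) z(4) by (rule star_subalgebraD)
    show "inverse c *\<^sub>C z \<noteq> 0" using c0 z(1) by simp
    show "projection (inverse c *\<^sub>C z)"
      using c0 by (simp add: projection_def selfadjoint_def star_scaleC z(2) c_real
          mult_scaleC_left mult_scaleC_right scaleC_scaleC zz)
    \<comment> \<open>\<open>l\<close> is a factor of \<open>c\<close>.\<close>
    show "l \<noteq> 0" using c0 by (auto simp: c_def)
    show "x * inverse c *\<^sub>C z = l *\<^sub>C inverse c *\<^sub>C z"
      by (simp add: mult_scaleC_right z(3) scaleC_scaleC mult.commute)
  qed
qed

lemma projection_selfadjoint: "projection p \<Longrightarrow> star p = p"
  and projection_idem: "projection p \<Longrightarrow> p * p = p"
  by (auto simp: projection_def selfadjoint_def)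

text \<open>The compression \<open>p * a * p\<close> is self-adjoint and equals
  \<open>l *\<^sub>C p\<close>.\<close>

lemma eigenvalue_of_selfadjoint_real:
  fixes a :: "'a::cstar_algebra"
  assumes "selfadjoint a" "projection p" "p \<noteq> 0" "a * p = l *\<^sub>C p"
  obtains r :: real where "l = of_real r"
proof -
  have pap: "p * (a * p) = l *\<^sub>C p"
    using assms by (simp add: mult_scaleC_right projection_idem)
  have "star (p * (a * p)) = p * (a * p)"
    by (metis assms(1,2) mult.assoc projection_selfadjoint selfadjoint_def star_mult)
  then have "cnj l *\<^sub>C p = l *\<^sub>C p"
    by (simp only: pap star_scaleC projection_selfadjoint[OF assms(2)])
  then have "cnj l = l" using assms(3) by simp
  then show ?thesis using that by (metis Reals_cnj_iff Reals_cases)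
qed

text \<open>Eigenvalues may repeat or vanish. Thus a largest family splits each eigenspace as finely
  as possible and also covers the part of \<open>B\<close> that \<open>a\<close>
  annihilates.\<close>

definition eigenprojections :: "'a::cstar_algebra set \<Rightarrow> 'a \<Rightarrow> 'a set \<Rightarrow> bool"
  where "eigenprojections B a P \<longleftrightarrow> finite P \<and> P \<subseteq> B \<and> 0 \<notin> P \<and>
    (\<forall>p\<in>P. projection p \<and> (\<exists>l. a * p = l *\<^sub>C p)) \<and> pairwise (\<lambda>p q. p * q = 0) P"

lemma orthogonal_projections_sum_mult:
  assumes "finite P" "pairwise (\<lambda>p q. p * q = 0) P" "\<And>p. p \<in> P \<Longrightarrow> projection p" "q \<in> P"
  shows "(\<Sum>p\<in>P. f p *\<^sub>C p) * q = f q *\<^sub>C (q::'a::cstar_algebra)"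
proof -
  have "(\<Sum>p\<in>P. f p *\<^sub>C p) * q = (\<Sum>p\<in>P. if p = q then f q *\<^sub>C q else 0)"
    unfolding sum_distrib_right using assms
    by (intro sum.cong) (auto simp: mult_scaleC_left projection_idem pairwise_def)
  also have "\<dots> = f q *\<^sub>C q" using assms by simp
  finally show ?thesis .
qed

text \<open>Multiplying a linear relation by \<open>q\<close> isolates the coefficient of
  \<open>q\<close>. Hence a finite spanning set of \<open>B\<close> bounds the size of these
  families.\<close>

lemma eigenprojections_independent:
  assumes "eigenprojections B a P"
  shows "cvec.independent P"
proof
  assume "cvec.dependent P"
  then obtain u q where u: "q \<in> P" "u q \<noteq> 0" "(\<Sum>v\<in>P. u v *\<^sub>C v) = 0"
    using assms by (auto simp: eigenprojections_def cvec.dependent_finite)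
  then have "u q *\<^sub>C q = 0"
    using orthogonal_projections_sum_mult[of P q u] assms by (auto simp: eigenprojections_def)
  then show False using u assms by (auto simp: eigenprojections_def)
qed

text \<open>Orthogonality on one side suffices, as adjoints give the other side. A member of
  \<open>P\<close> orthogonal to itself would be zero, so \<open>q\<close> is new and the family
  really grows.\<close>

lemma eigenprojections_insert:
  assumes "eigenprojections B a P" "q \<in> B" "q \<noteq> 0" "projection q" "a * q = l *\<^sub>C q"
    and orth: "\<And>p. p \<in> P \<Longrightarrow> p * q = 0"
  shows "eigenprojections B a (insert q P)" "q \<notin> P"
proof -
  show "q \<notin> P" using orth[of q] assms(3,4) by (auto simp: projection_idem)
  have "q * p = 0" if "p \<in> P" for p
    using orth[OF that] that assms(1,4)
    by (metis eigenprojections_def projection_selfadjoint star_mult star_zero)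
  then show "eigenprojections B a (insert q P)"
    using assms by (auto simp: eigenprojections_def pairwise_insert)
qed

text \<open>A family of maximal cardinality can neither be refined nor enlarged: this makes every corner
  \<open>p B p\<close> one-dimensional and the sum of the family a unit of \<open>B\<close>.\<close>

lemma minimal_eigenprojections:
  fixes a :: "'a::cstar_algebra"
  assumes fd: "fin_dim B" and B: "star_subalgebra B" and a: "a \<in> B" "selfadjoint a"
  obtains P and l :: "'a \<Rightarrow> real" where "finite P" "P \<subseteq> B" "0 \<notin> P"
    "\<And>p. p \<in> P \<Longrightarrow> projection p" "pairwise (\<lambda>p q. p * q = 0) P"
    "a = (\<Sum>p\<in>P. of_real (l p) *\<^sub>C p)"
    "\<And>p x. p \<in> P \<Longrightarrow> x \<in> B \<Longrightarrow> \<exists>c. p * x * p = c *\<^sub>C p"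
    "\<And>x. x \<in> B \<Longrightarrow> \<Sum>P * x = x"
proof -
  obtain X where X: "finite X" "cvec.span X = B" using fd by (auto simp: fin_dim_def)
  have bound: "card P \<le> card X" if "eigenprojections B a P" for P
    using cvec.independent_span_bound[OF X(1) eigenprojections_independent[OF that]] that X(2)
    by (auto simp: eigenprojections_def)
  have "eigenprojections B a {}" by (simp add: eigenprojections_def)
  then obtain P where P: "eigenprojections B a P"
    and max: "\<And>Q. eigenprojections B a Q \<Longrightarrow> card Q \<le> card P"
    using ex_has_greatest_nat[of "eigenprojections B a" "{}" card "Suc (card X)"] bound
    by (metis le_imp_less_Suc)
  note P_simps = P[unfolded eigenprojections_def]
  have fin: "finite P" and PB: "P \<subseteq> B" and P0: "0 \<notin> P"
    and proj: "\<And>p. p \<in> P \<Longrightarrow> projection p" and orth: "pairwise (\<lambda>p q. p * q = 0) P"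
    using P_simps by auto
  have no_more: False if "q \<in> B" "q \<noteq> 0" "projection q" "a * q = c *\<^sub>C q"
    "\<And>p. p \<in> P \<Longrightarrow> p * q = 0" for q c
    using eigenprojections_insert[OF P that] max[of "insert q P"] fin by simp
  have "\<exists>r::real. a * p = of_real r *\<^sub>C p" if "p \<in> P" for p
    using P_simps that by (metis eigenvalue_of_selfadjoint_real a(2))
  then obtain l :: "'a \<Rightarrow> real" where l: "\<And>p. p \<in> P \<Longrightarrow> a * p = of_real (l p) *\<^sub>C p" by metis
  \<comment> \<open>\<open>y\<close> acts on \<open>q\<close> as a nonzero scalar, so whatever
    annihilates \<open>y\<close> from the left annihilates \<open>q\<close>.\<close>
  have vanish: "p * q = 0" if "p * y = 0" "y * q = c *\<^sub>C q" "c \<noteq> 0" for p q y :: 'a and c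
  proof -
    have "c *\<^sub>C (p * q) = (p * y) * q" by (metis mult.assoc mult_scaleC_right that(2))
    then show ?thesis using that(1,3) by simp
  qed
  \<comment> \<open>Otherwise the difference \<open>y\<close> is self-adjoint, nonzero and
    orthogonal to \<open>P\<close>. An eigenprojection \<open>q\<close> of \<open>y\<close> is then
    orthogonal to \<open>P\<close> too, hence \<open>s * q = 0\<close>, so \<open>q\<close> is an
    eigenprojection of \<open>a\<close> and enlarges the family.\<close>
  have a_eq: "a = (\<Sum>p\<in>P. of_real (l p) *\<^sub>C p)"
  proof (rule ccontr)
    define s where "s = (\<Sum>p\<in>P. complex_of_real (l p) *\<^sub>C p)"
    define y where "y = a - s"
    assume "a \<noteq> (\<Sum>p\<in>P. of_real (l p) *\<^sub>C p)"
    then have "y \<noteq> 0" by (simp add: y_def s_def)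
    have "s \<in> B" unfolding s_def using B PB
      by (intro cvec.subspace_sum) (auto simp: star_subalgebraD)
    then have "y \<in> B" unfolding y_def using B a by (intro star_subalgebraD)
    have "star s = s"
      using proj by (simp add: s_def star_sum star_scaleC projection_selfadjoint)
    then have sy: "star y = y" using a(2) by (simp add: y_def star_diff selfadjoint_def)
    have "y * p = 0" if "p \<in> P" for p
      using orthogonal_projections_sum_mult[OF fin orth proj that, of "\<lambda>p. of_real (l p)"] that
      by (simp add: y_def s_def left_diff_distrib l)
    then have py: "p * y = 0" if "p \<in> P" for p
      using that by (metis sy star_mult star_zero proj projection_selfadjoint)
    obtain q c where q: "q \<in> B" "q \<noteq> 0" "projection q" "c \<noteq> 0" "y * q = c *\<^sub>C q"
      using eigenprojection_exists[OF fd B \<open>y \<in> B\<close> _ \<open>y \<noteq> 0\<close>] sy by (auto simp: selfadjoint_def)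
    have pq: "p * q = 0" if "p \<in> P" for p
      using py[OF that] q(5,4) by (rule vanish)
    have "s * q = 0" by (simp add: s_def sum_distrib_right mult_scaleC_left pq)
    then have "a * q = c *\<^sub>C q" using q(5) by (simp add: y_def left_diff_distrib)
    from no_more[OF q(1-3) this pq] show False .
  qed
  \<comment> \<open>An eigenprojection \<open>q\<close> of \<open>x\<close> lies below
    \<open>p\<close>. If it differed from \<open>p\<close>, replacing \<open>p\<close> by
    \<open>q\<close> and \<open>p - q\<close> would give a family with one more member.\<close>
  have corner_sa: "\<exists>c. x = c *\<^sub>C p" if p: "p \<in> P" and x: "x \<in> B" "selfadjoint x" "p * x = x" for p x
  proof (cases "x = 0")
    case True
    then show ?thesis by (intro exI[of _ 0]) simp
  next
    case False
    obtain q c where q: "q \<in> B" "q \<noteq> 0" "projection q" "c \<noteq> 0" "x * q = c *\<^sub>C q"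
      using eigenprojection_exists[OF fd B x(1,2) False] by auto
    have xp: "x * p = x" using x(2,3) proj[OF p]
      by (metis projection_selfadjoint selfadjoint_def star_mult)
    have "c *\<^sub>C (p * q) = c *\<^sub>C q"
      by (metis mult.assoc mult_scaleC_right q(5) x(3))
    then have pq: "p * q = q" using q(4) by simp
    then have qp: "q * p = q" using proj[OF p] q(3) by (metis projection_selfadjoint star_mult)
    have qq: "q * q = q" using q(3) by (rule projection_idem)
    have "q = p"
    proof (rule ccontr)
      assume "q \<noteq> p"
      let ?Q = "P - {p}"
      have Q: "eigenprojections B a ?Q"
        using P by (auto simp: eigenprojections_def pairwise_def)
      have aq: "a * q = of_real (l p) *\<^sub>C q"
        using l[OF p] pq by (metis mult.assoc mult_scaleC_left)
      have Qp: "p' * p = 0" if "p' \<in> ?Q" for p'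
        using orth that p by (auto simp: pairwise_def)
      then have Qq: "p' * q = 0" if "p' \<in> ?Q" for p'
        using that pq by (metis mult.assoc mult_zero_left)
      note Q1 = eigenprojections_insert[OF Q q(1-3) aq Qq]
      have "p - q \<in> B" using B PB p q(1) by (auto intro: star_subalgebraD)
      moreover have "p - q \<noteq> 0" using \<open>q \<noteq> p\<close> by simp
      moreover have "projection (p - q)"
        using proj[OF p] q(3) by (simp add: projection_def selfadjoint_def star_diff algebra_simps pq qp)
      moreover have "a * (p - q) = of_real (l p) *\<^sub>C (p - q)"
        by (simp add: right_diff_distrib l[OF p] aq cvec.scale_right_diff_distrib)
      moreover have "p' * (p - q) = 0" if "p' \<in> insert q ?Q" for p'
        using that Qp Qq by (auto simp: right_diff_distrib qp qq)
      ultimately have Q2: "eigenprojections B a (insert (p - q) (insert q ?Q))" "p - q \<notin> insert q ?Q"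
        using eigenprojections_insert[OF Q1(1)] by blast+
      have "card (insert (p - q) (insert q ?Q)) = Suc (Suc (card ?Q))"
        using Q1(2) Q2(2) fin by simp
      also have "\<dots> = Suc (card P)" using fin p by (metis card_Suc_Diff1)
      finally show False using max[OF Q2(1)] by simp
    qed
    then have "x = c *\<^sub>C p" using q(5) xp by simp
    then show ?thesis ..
  qed
  have corner: "\<exists>c. p * x * p = c *\<^sub>C p" if p: "p \<in> P" and x: "x \<in> B" for p x
  proof -
    define w where "w = p * x * p"
    have "w \<in> B" unfolding w_def using B PB p x by (auto intro!: star_subalgebraD)
    \<comment> \<open>\<open>p\<close> fixes both \<open>w\<close> and \<open>star w\<close>, so the
      self-adjoint parts of \<open>w\<close> satisfy the hypotheses of
      \<open>corner_sa\<close>.\<close>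
    have pw: "p * w = w" "p * star w = star w" using proj[OF p]
      by (simp_all add: w_def star_mult projection_selfadjoint projection_idem mult.assoc)
        (simp_all add: projection_idem flip: mult.assoc)
    then have "p * re_part w = re_part w" "p * im_part w = im_part w"
      by (simp_all add: re_part_def im_part_def mult_scaleC_right distrib_left right_diff_distrib)
    then obtain c d where "re_part w = c *\<^sub>C p" "im_part w = d *\<^sub>C p"
      using corner_sa[OF p] re_im_part_closed[OF B \<open>w \<in> B\<close>] by (metis selfadjoint_re_part selfadjoint_im_part)
    then have "w = (c + \<i> * d) *\<^sub>C p"
      by (metis re_part_plus_im_part scaleC_add_left scaleC_scaleC)
    then show ?thesis unfolding w_def ..
  qed
  \<comment> \<open>If \<open>y\<close> were nonzero, \<open>y * star y\<close> would have an
    eigenprojection \<open>q\<close> orthogonal to \<open>P\<close>. As \<open>a\<close> is a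
    combination of \<open>P\<close>, it annihilates \<open>q\<close>; so \<open>q\<close> enlarges
    the family, with eigenvalue 0.\<close>
  have unit: "\<Sum>P * x = x" if x: "x \<in> B" for x
  proof (rule ccontr)
    assume "\<Sum>P * x \<noteq> x"
    define y where "y = x - \<Sum>P * x"
    have "y \<noteq> 0" using \<open>\<Sum>P * x \<noteq> x\<close> by (simp add: y_def)
    have "\<Sum>P \<in> B" using B PB cvec.subspace_sum[of B P "\<lambda>p. p"] by (auto simp: star_subalgebraD)
    then have yB: "y * star y \<in> B" using B x by (auto simp: y_def intro!: star_subalgebraD)
    have sum_mult: "\<Sum>P * p = p" if "p \<in> P" for p
      using orthogonal_projections_sum_mult[OF fin orth proj that, of "\<lambda>_. 1"] by (simp add: scaleC_one)
    have "star (\<Sum>P) = \<Sum>P" using proj by (simp add: star_sum projection_selfadjoint)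
    then have "p * \<Sum>P = p" if "p \<in> P" for p
      using sum_mult[OF that] proj[OF that] by (metis star_mult projection_selfadjoint)
    then have py: "p * (y * star y) = 0" if "p \<in> P" for p
      using that by (simp add: y_def right_diff_distrib flip: mult.assoc)
    obtain q c where q: "q \<in> B" "q \<noteq> 0" "projection q" "c \<noteq> 0" "y * star y * q = c *\<^sub>C q"
      using eigenprojection_exists[OF fd B yB] \<open>y \<noteq> 0\<close> by (auto simp: selfadjoint_def star_mult star_star)
    have pq: "p * q = 0" if "p \<in> P" for p
      using py[OF that] q(5,4) by (rule vanish)
    have "a * q = 0 *\<^sub>C q" by (simp add: a_eq sum_distrib_right mult_scaleC_left pq)
    from no_more[OF q(1-3) this pq] show False .
  qed
  show ?thesis using that[OF fin PB P0 proj orth a_eq corner unit] .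
qed

section \<open>Perturbation to a generating pair\<close>

lemma perturb_injective_nonzero:
  fixes l :: "'a \<Rightarrow> real"
  assumes "finite P" "\<delta> > 0"
  shows "\<exists>m. inj_on m P \<and> (\<forall>p\<in>P. m p \<noteq> 0 \<and> \<bar>m p - l p\<bar> < \<delta>)"
  using assms(1)
proof (induction P)
  case (insert q P)
  then obtain m where m: "inj_on m P" "\<forall>p\<in>P. m p \<noteq> 0 \<and> \<bar>m p - l p\<bar> < \<delta>" by blast
  \<comment> \<open>Only 0 and the finitely many values already chosen are excluded from an
    interval.\<close>
  have "infinite ({l q - \<delta><..<l q + \<delta>} - insert 0 (m ` P))"
    using \<open>\<delta> > 0\<close> insert.hyps(1) by (intro Diff_infinite_finite) auto
  then obtain t where t: "t \<in> {l q - \<delta><..<l q + \<delta>}" "t \<noteq> 0" "t \<notin> m ` P"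
    using infinite_imp_nonempty by (metis Diff_iff all_not_in_conv insertCI)
  have "inj_on (m(q := t)) (insert q P)"
    using m(1) t(3) insert.hyps(2) by (auto simp: inj_on_def)
  moreover have "\<forall>p\<in>insert q P. (m(q := t)) p \<noteq> 0 \<and> \<bar>(m(q := t)) p - l p\<bar> < \<delta>"
    using m(2) t by auto
  ultimately show ?case by blast
qed simp

text \<open>The pairs are treated one at a time. Adding \<open>t *\<^sub>R z\<close> makes the new
  corner nonzero, and each pair, old or new, rules out at most one \<open>t\<close>.\<close>

lemma perturb_nonzero_corners:
  fixes a :: "'a::cstar_algebra"
  assumes B: "star_subalgebra B" and "finite R"
    and R: "\<And>p q. (p, q) \<in> R \<Longrightarrow> \<exists>z\<in>B. p * z * q \<noteq> 0"
    and a: "a \<in> B" "selfadjoint a" and "\<epsilon> > 0"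
  shows "\<exists>b\<in>B. selfadjoint b \<and> norm (b - a) < \<epsilon> \<and> (\<forall>(p, q)\<in>R. p * b * q \<noteq> 0)"
  using assms(2) R \<open>\<epsilon> > 0\<close>
proof (induction R arbitrary: \<epsilon>)
  case empty
  then show ?case using a by (intro bexI[of _ a]) auto
next
  case (insert r R)
  obtain p q where r: "r = (p, q)" by fastforce
  obtain b where b: "b \<in> B" "selfadjoint b" "norm (b - a) < \<epsilon> / 2" "\<forall>(p, q)\<in>R. p * b * q \<noteq> 0"
    using insert.IH[of "\<epsilon> / 2"] insert.prems by auto
  obtain w where w: "w \<in> B" "p * w * q \<noteq> 0" using insert.prems(1) r by blast
  have "p * w * q = p * re_part w * q + \<i> *\<^sub>C (p * im_part w * q)"
    by (metis re_part_plus_im_part distrib_left distrib_right mult_scaleC_left mult_scaleC_right)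
  \<comment> \<open>The perturbation must stay self-adjoint, so \<open>w\<close> is replaced by one
    of its self-adjoint parts.\<close>
  then have "p * re_part w * q \<noteq> 0 \<or> p * im_part w * q \<noteq> 0" using w(2) by auto
  then obtain z where z: "z \<in> B" "selfadjoint z" "p * z * q \<noteq> 0"
    using re_im_part_closed[OF B w(1)] by auto
  define bad where "bad p q = {t::real. p * (b + t *\<^sub>R z) * q = 0}" for p q
  \<comment> \<open>The corner is an affine function of \<open>t\<close> that is not identically
    zero, so it vanishes for at most one \<open>t\<close>.\<close>
  have fin: "finite (bad p' q')" if "p' * b * q' \<noteq> 0 \<or> p' * z * q' \<noteq> 0" for p' q'
  proof -
    have expand: "p' * (b + t *\<^sub>R z) * q' = p' * b * q' + t *\<^sub>R (p' * z * q')" for t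
      by (simp add: distrib_left distrib_right)
    have "s = t" if "s \<in> bad p' q'" "t \<in> bad p' q'" for s t
    proof (rule ccontr)
      assume "s \<noteq> t"
      have "p' * b * q' + s *\<^sub>R (p' * z * q') = p' * b * q' + t *\<^sub>R (p' * z * q')"
        using that by (simp add: bad_def expand)
      then have "p' * z * q' = 0" using \<open>s \<noteq> t\<close> by simp
      then show False using that(1) \<open>p' * b * q' \<noteq> 0 \<or> p' * z * q' \<noteq> 0\<close> by (simp add: bad_def expand)
    qed
    then have "bad p' q' \<subseteq> {SOME t. t \<in> bad p' q'}"
      by (metis singletonI someI subsetI)
    then show ?thesis using finite_subset by blast
  qed
  \<comment> \<open>This keeps \<open>t *\<^sub>R z\<close> within half of \<epsilon>, the other
    half being spent on \<open>b\<close>; the summand 1 avoids division by zero.\<close>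
  define \<delta> where "\<delta> = \<epsilon> / 2 / (norm z + 1)"
  have "\<delta> > 0" using insert.prems(2) by (simp add: \<delta>_def add_nonneg_pos)
  have "finite (\<Union>(p, q)\<in>insert r R. bad p q)"
  proof (intro finite_UN_I)
    fix s assume "s \<in> insert r R"
    then show "finite (case s of (p, q) \<Rightarrow> bad p q)"
      using b(4) z(3) r by (auto split: prod.splits intro!: fin)
  qed (use insert.hyps in simp)
  then have "infinite ({0<..<\<delta>} - (\<Union>(p, q)\<in>insert r R. bad p q))"
    using \<open>\<delta> > 0\<close> by (intro Diff_infinite_finite) auto
  then obtain t where t: "0 < t" "t < \<delta>" "t \<notin> (\<Union>(p, q)\<in>insert r R. bad p q)"
    by (metis Diff_iff ex_in_conv greaterThanLessThan_iff infinite_imp_nonempty)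
  have "norm (t *\<^sub>R z) \<le> \<delta> * norm z" using t by (simp add: mult_right_mono)
  also have "\<dots> \<le> \<delta> * (norm z + 1)" using \<open>\<delta> > 0\<close> by (intro mult_left_mono) auto
  also have "\<dots> = \<epsilon> / 2"
    using norm_ge_zero[of z] by (simp add: \<delta>_def field_simps add_nonneg_eq_0_iff)
  finally have tz: "norm (t *\<^sub>R z) \<le> \<epsilon> / 2" .
  show ?case
  proof (intro bexI conjI)
    show "b + t *\<^sub>R z \<in> B"
      using B b(1) z(1) by (simp add: scaleR_conv_scaleC star_subalgebraD)
    show "selfadjoint (b + t *\<^sub>R z)"
      using b(2) z(2) by (simp add: selfadjoint_def scaleR_conv_scaleC star_add star_scaleC)
    have "norm (b + t *\<^sub>R z - a) \<le> norm (b - a) + norm (t *\<^sub>R z)"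
      using norm_triangle_ineq[of "b - a" "t *\<^sub>R z"] by (simp add: algebra_simps)
    then show "norm (b + t *\<^sub>R z - a) < \<epsilon>" using b(3) tz by linarith
    show "\<forall>(p, q)\<in>insert r R. p * (b + t *\<^sub>R z) * q \<noteq> 0"
      using t(3) unfolding bad_def by blast
  qed
qed

text \<open>Elimination as for a Vandermonde system, without using a unit: multiplying a combination
  by \<open>b\<close> and subtracting \<open>m q\<close> times it removes \<open>q\<close>.
  Injectivity of \<open>m\<close> keeps the other coefficients nonzero.\<close>

lemma eigenprojections_in_subalgebra:
  fixes m :: "'a::cstar_algebra \<Rightarrow> complex"
  assumes S: "star_subalgebra S" and "finite P" "pairwise (\<lambda>p q. p * q = 0) P"
    and proj: "\<And>p. p \<in> P \<Longrightarrow> projection p"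
    and m: "inj_on m P" "\<And>p. p \<in> P \<Longrightarrow> m p \<noteq> 0" and b: "(\<Sum>p\<in>P. m p *\<^sub>C p) \<in> S"
  shows "P \<subseteq> S"
proof -
  define b where "b = (\<Sum>p\<in>P. m p *\<^sub>C p)"
  have bp: "b * p = m p *\<^sub>C p" if "p \<in> P" for p
    unfolding b_def using assms that by (intro orthogonal_projections_sum_mult) auto
  \<comment> \<open>The coefficients change in each elimination, so the induction ranges over all
    families \<open>u\<close> of nonzero coefficients; \<open>u = m\<close> is the case
    wanted.\<close>
  have "I \<subseteq> S" if "finite I" "I \<subseteq> P" "(\<Sum>p\<in>I. u p *\<^sub>C p) \<in> S" "\<And>p. p \<in> I \<Longrightarrow> u p \<noteq> 0" for I u
    using that
  proof (induction I arbitrary: u)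
    case (insert q I)
    let ?x = "\<Sum>p\<in>insert q I. u p *\<^sub>C p"
    let ?v = "\<lambda>p. u p * (m p - m q)"
    have "b * ?x - m q *\<^sub>C ?x = (\<Sum>p\<in>insert q I. ?v p *\<^sub>C p)"
    proof -
      have "b * ?x = (\<Sum>p\<in>insert q I. (u p * m p) *\<^sub>C p)"
        unfolding sum_distrib_left
        by (rule sum.cong) (use insert.prems(1) in \<open>auto simp: mult_scaleC_right bp scaleC_scaleC\<close>)
      moreover have "m q *\<^sub>C ?x = (\<Sum>p\<in>insert q I. (m q * u p) *\<^sub>C p)"
        unfolding cvec.scale_sum_right scaleC_scaleC ..
      moreover have "?v p *\<^sub>C p = (u p * m p) *\<^sub>C p - (m q * u p) *\<^sub>C p" for p
        by (simp add: mult.commute right_diff_distrib flip: cvec.scale_left_diff_distrib)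
      ultimately show ?thesis by (simp only: sum_subtractf)
    qed
    also have "\<dots> = (\<Sum>p\<in>I. ?v p *\<^sub>C p)" using insert.hyps by simp
    finally have "(\<Sum>p\<in>I. ?v p *\<^sub>C p) = b * ?x - m q *\<^sub>C ?x" ..
    also have "\<dots> \<in> S"
      using b insert.prems(2) unfolding b_def[symmetric] by (intro star_subalgebraD(4-6)[OF S])
    finally have "(\<Sum>p\<in>I. ?v p *\<^sub>C p) \<in> S" .
    moreover have "?v p \<noteq> 0" if "p \<in> I" for p
      using that insert.prems(1,3) insert.hyps(2) m(1) by (auto simp: inj_on_def)
    ultimately have I: "I \<subseteq> S" using insert.IH[of ?v] insert.prems(1) by auto
    then have "(\<Sum>p\<in>I. u p *\<^sub>C p) \<in> S"
      using S by (intro cvec.subspace_sum) (auto simp: star_subalgebraD)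
    then have "?x - (\<Sum>p\<in>I. u p *\<^sub>C p) \<in> S" by (rule star_subalgebraD(4)[OF S insert.prems(2)])
    then have "u q *\<^sub>C q \<in> S" using insert.hyps by simp
    then have "inverse (u q) *\<^sub>C u q *\<^sub>C q \<in> S" by (rule star_subalgebraD(5)[OF S])
    then show ?case using I insert.prems(3) by (simp add: scaleC_scaleC scaleC_one)
  qed simp
  from this[of P m] show ?thesis using assms by simp
qed

text \<open>Stated for every star-subalgebra containing both elements, the conclusion applies both
  to the algebra generated by a pair and to the one generated by
  \<open>b0 + \<i> *\<^sub>C b1\<close>.\<close>

lemma perturb_to_generators:
  fixes a0 a1 :: "'a::cstar_algebra"
  assumes fd: "fin_dim B" and B: "star_subalgebra B"
    and a0: "a0 \<in> B" "selfadjoint a0" and a1: "a1 \<in> B" "selfadjoint a1" and "\<epsilon> > 0"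
  obtains b0 b1 where "b0 \<in> B" "selfadjoint b0" "norm (b0 - a0) < \<epsilon>"
    "b1 \<in> B" "selfadjoint b1" "norm (b1 - a1) < \<epsilon>"
    "\<And>S. star_subalgebra S \<Longrightarrow> b0 \<in> S \<Longrightarrow> b1 \<in> S \<Longrightarrow> B \<subseteq> S"
proof -
  obtain P and l :: "'a \<Rightarrow> real" where fin: "finite P" and PB: "P \<subseteq> B" and P0: "0 \<notin> P"
    and proj: "\<And>p. p \<in> P \<Longrightarrow> projection p" and orth: "pairwise (\<lambda>p q. p * q = 0) P"
    and a0_eq: "a0 = (\<Sum>p\<in>P. of_real (l p) *\<^sub>C p)"
    and corner: "\<And>p x. p \<in> P \<Longrightarrow> x \<in> B \<Longrightarrow> \<exists>c. p * x * p = c *\<^sub>C p"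
    and unit: "\<And>x. x \<in> B \<Longrightarrow> \<Sum>P * x = x"
    using minimal_eigenprojections[OF fd B a0] by blast
  \<comment> \<open>Errors below \<open>\<epsilon> / K\<close> in the eigenvalues add up to at most
    \<open>\<epsilon> / K * (K - 1)\<close>. The summand 1 makes this strictly less than \<epsilon>
    and keeps \<open>K\<close> positive if \<open>P\<close> is empty.\<close>
  define K where "K = (\<Sum>p\<in>P. norm p) + 1"
  have "K > 0" unfolding K_def by (intro add_nonneg_pos sum_nonneg) auto
  obtain m where m: "inj_on m P" "\<And>p. p \<in> P \<Longrightarrow> m p \<noteq> 0" "\<And>p. p \<in> P \<Longrightarrow> \<bar>m p - l p\<bar> < \<epsilon> / K"
    using perturb_injective_nonzero[OF fin, of "\<epsilon> / K" l] \<open>K > 0\<close> \<open>\<epsilon> > 0\<close> by auto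
  define b0 where "b0 = (\<Sum>p\<in>P. of_real (m p) *\<^sub>C p)"
  have b0B: "b0 \<in> B" unfolding b0_def using B PB
    by (intro cvec.subspace_sum) (auto simp: star_subalgebraD)
  have b0_sa: "selfadjoint b0"
    using proj by (simp add: selfadjoint_def b0_def star_sum star_scaleC projection_selfadjoint)
  have "norm (b0 - a0) = norm (\<Sum>p\<in>P. of_real (m p - l p) *\<^sub>C p)"
    by (simp add: b0_def a0_eq cvec.scale_left_diff_distrib flip: sum_subtractf)
  also have "\<dots> \<le> (\<Sum>p\<in>P. \<bar>m p - l p\<bar> * norm p)"
    by (rule order_trans[OF norm_sum]) (simp only: norm_scaleC norm_of_real order_refl)
  also have "\<dots> \<le> (\<Sum>p\<in>P. \<epsilon> / K * norm p)"
    using m(3) by (intro sum_mono mult_right_mono) (auto simp: less_imp_le)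
  also have "\<dots> = \<epsilon> / K * (K - 1)" by (simp add: K_def sum_distrib_left)
  also have "\<dots> < \<epsilon>" using \<open>K > 0\<close> \<open>\<epsilon> > 0\<close> by (simp add: field_simps)
  finally have b0_near: "norm (b0 - a0) < \<epsilon>" .
  define R where "R = {(p, q). p \<in> P \<and> q \<in> P \<and> (\<exists>z\<in>B. p * z * q \<noteq> 0)}"
  have "finite R"
    by (rule finite_subset[of _ "P \<times> P"]) (auto simp: R_def fin)
  obtain b1 where b1: "b1 \<in> B" "selfadjoint b1" "norm (b1 - a1) < \<epsilon>" "\<forall>(p, q)\<in>R. p * b1 * q \<noteq> 0"
    using perturb_nonzero_corners[OF B \<open>finite R\<close> _ a1 \<open>\<epsilon> > 0\<close>] by (auto simp: R_def)
  have "x \<in> S" if S: "star_subalgebra S" "b0 \<in> S" "b1 \<in> S" and x: "x \<in> B" for S x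
  proof -
    have PS: "P \<subseteq> S"
      by (rule eigenprojections_in_subalgebra[OF S(1) fin orth proj, of "\<lambda>p. of_real (m p)"])
        (use m S(2) in \<open>auto simp: inj_on_def b0_def\<close>)
    \<comment> \<open>The corner \<open>u = p * b1 * q\<close> spans \<open>p B q\<close>:
      \<open>u * star u\<close> is a nonzero multiple of \<open>p\<close>, and
      \<open>star u * (p * x * q)\<close> lies in the corner of \<open>q\<close>, hence is a
      multiple of \<open>q\<close>. So \<open>p * x * q\<close> is a multiple of
      \<open>u\<close>.\<close>
    have pxq: "p * x * q \<in> S" if "p \<in> P" "q \<in> P" for p q
    proof (cases "p * x * q = 0")
      case True
      then show ?thesis using S(1) by (simp add: star_subalgebraD)
    next
      case False
      define u where "u = p * b1 * q"
      have "(p, q) \<in> R" using that x False by (auto simp: R_def)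
      with b1(4) have "u \<noteq> 0" by (auto simp: u_def)
      have "u \<in> S" using S PS that by (auto simp: u_def intro!: star_subalgebraD)
      have proj_pq: "p * p = p" "q * q = q" "star p = p" "star q = q"
        using that proj by (simp_all add: projection_idem projection_selfadjoint)
      have star_u: "star u = q * b1 * p"
        using b1(2) by (simp add: u_def star_mult proj_pq selfadjoint_def mult.assoc)
      have "b1 * q * b1 \<in> B" using B PB b1(1) that by (auto intro!: star_subalgebraD)
      then obtain c where c: "p * (b1 * q * b1) * p = c *\<^sub>C p" using corner \<open>p \<in> P\<close> by blast
      have "u * star u = p * (b1 * (q * q) * b1) * p"
        by (simp only: star_u) (simp only: u_def mult.assoc)
      then have uu: "u * star u = c *\<^sub>C p" using c by (simp add: proj_pq)
      then have "c \<noteq> 0" using \<open>u \<noteq> 0\<close> by (metis cvec.scale_zero_left mult_star_self_eq_0_iff)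
      have "b1 * p * x \<in> B" using B PB b1(1) that x by (auto intro!: star_subalgebraD)
      then obtain d where d: "q * (b1 * p * x) * q = d *\<^sub>C q" using corner \<open>q \<in> P\<close> by blast
      have "c *\<^sub>C (p * x * q) = c *\<^sub>C p * (p * x * q)"
        by (metis mult.assoc mult_scaleC_left proj_pq(1))
      also have "\<dots> = u * (q * b1 * p * (p * x * q))"
        by (simp only: uu[symmetric] star_u mult.assoc)
      also have "q * b1 * p * (p * x * q) = q * b1 * (p * p) * x * q" by (simp only: mult.assoc)
      also have "\<dots> = d *\<^sub>C q" by (metis d mult.assoc proj_pq(1))
      also have "u * d *\<^sub>C q = d *\<^sub>C u"
        by (metis mult.assoc mult_scaleC_right proj_pq(2) u_def)
      finally have "p * x * q = (inverse c * d) *\<^sub>C u"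
        using \<open>c \<noteq> 0\<close> by (metis left_inverse scaleC_one scaleC_scaleC)
      then show ?thesis using S(1) \<open>u \<in> S\<close> by (simp add: star_subalgebraD)
    qed
    \<comment> \<open>By adjoints the left unit is also a right unit, and \<open>x\<close> is the
      sum of its corners.\<close>
    have "star (\<Sum>P) = \<Sum>P" using proj by (simp add: star_sum projection_selfadjoint)
    then have "x * \<Sum>P = x"
      using unit[of "star x"] B x by (metis star_mult star_star star_subalgebraD(7))
    then have "x = \<Sum>P * x * \<Sum>P" using unit[OF x] by simp
    also have "\<dots> = (\<Sum>q\<in>P. \<Sum>p\<in>P. p * x * q)" by (simp add: sum_distrib_left sum_distrib_right)
    also have "\<dots> \<in> S" using pxq star_subalgebraD(1)[OF S(1)] by (intro cvec.subspace_sum) auto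
    finally show "x \<in> S" .
  qed
  then show ?thesis using that[OF b0B b0_sa b0_near b1(1-3)] by blast
qed

section \<open>Approximation by finite-dimensional subalgebras\<close>

text \<open>Unlike in \<open>locally_fin_dim\<close>, closedness of the approximating subalgebras is not demanded
  (although it is automatic), so that it need not be proved.\<close>

definition fin_dim_approximable :: "'a::cstar_algebra itself \<Rightarrow> bool"
  where "fin_dim_approximable _ \<longleftrightarrow>
    (\<forall>F::'a set. \<forall>\<epsilon>>0. finite F \<longrightarrow>
       (\<exists>B. star_subalgebra B \<and> fin_dim B \<and> (\<forall>x\<in>F. approx_in \<epsilon> x B)))"

lemma locally_fin_dim_imp_approximable:
  "locally_fin_dim TYPE('a::cstar_algebra) \<Longrightarrow> fin_dim_approximable TYPE('a)"
  unfolding locally_fin_dim_def fin_dim_approximable_def sub_cstar_iff by blast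

lemma sub_cstar_cstar_generated: "sub_cstar (cstar_generated G)"
  unfolding cstar_generated_def
proof (rule hull_in)
  fix T :: "'a set set" assume "\<forall>S\<in>T. sub_cstar S"
  then show "sub_cstar (\<Inter>T)" unfolding sub_cstar_def
    by (auto intro!: cvec.subspace_Inter closed_Inter)
qed

lemma cstar_generated_superset: "G \<subseteq> cstar_generated G"
  unfolding cstar_generated_def by (rule hull_subset)

lemma cstar_generated_minimal: "G \<subseteq> S \<Longrightarrow> sub_cstar S \<Longrightarrow> cstar_generated G \<subseteq> S"
  unfolding cstar_generated_def by (rule hull_minimal)

text \<open>The approximants of \<open>a0\<close> and \<open>a1\<close> in \<open>B\<close> need not
  be self-adjoint; \<open>re_part\<close> makes them so without increasing the error. Half of
  \<epsilon> goes into this approximation, half into the perturbation inside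
  \<open>B\<close>.\<close>

lemma approximable_perturb:
  fixes a0 a1 c :: "'a::cstar_algebra"
  assumes "fin_dim_approximable TYPE('a)" "selfadjoint a0" "selfadjoint a1" "\<epsilon> > 0"
  obtains b0 b1 where "selfadjoint b0" "norm (b0 - a0) < \<epsilon>" "selfadjoint b1" "norm (b1 - a1) < \<epsilon>"
    "\<And>S. star_subalgebra S \<Longrightarrow> b0 \<in> S \<Longrightarrow> b1 \<in> S \<Longrightarrow> approx_in \<epsilon> c S"
proof -
  obtain B where B: "star_subalgebra B" "fin_dim B" "\<forall>x\<in>{a0, a1, c}. approx_in (\<epsilon>/2) x B"
    using assms(1,4) unfolding fin_dim_approximable_def
    by (meson finite.emptyI finite_insert half_gt_zero)
  obtain x0 x1 g where x: "x0 \<in> B" "norm (a0 - x0) < \<epsilon>/2" "x1 \<in> B" "norm (a1 - x1) < \<epsilon>/2"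
    and g: "g \<in> B" "norm (c - g) < \<epsilon>/2"
    using B(3) by (auto simp: approx_in_def)
  have re_sa: "re_part a = a" if "selfadjoint a" for a :: 'a
    using re_part_combination(1)[OF that, of 0] by (simp add: selfadjoint_def)
  obtain b0 b1 where b: "b0 \<in> B" "selfadjoint b0" "norm (b0 - re_part x0) < \<epsilon>/2"
    "b1 \<in> B" "selfadjoint b1" "norm (b1 - re_part x1) < \<epsilon>/2"
    "\<And>S. star_subalgebra S \<Longrightarrow> b0 \<in> S \<Longrightarrow> b1 \<in> S \<Longrightarrow> B \<subseteq> S"
    using perturb_to_generators[OF B(2,1), of "re_part x0" "re_part x1" "\<epsilon>/2"]
      re_im_part_closed[OF B(1)] x(1,3) assms(4) by auto
  have near: "norm (b' - a) < \<epsilon>"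
    if "selfadjoint a" "norm (a - x) < \<epsilon>/2" "norm (b' - re_part x) < \<epsilon>/2" for a x b' :: 'a
  proof -
    have "norm (re_part x - a) < \<epsilon>/2"
      using norm_re_part_le[of "a - x"] that by (simp add: re_part_diff re_sa norm_minus_commute)
    then show ?thesis
      using norm_triangle_ineq[of "b' - re_part x" "re_part x - a"] that(3) by simp
  qed
  show ?thesis
  proof (rule that[OF b(2) _ b(5)])
    show "norm (b0 - a0) < \<epsilon>" "norm (b1 - a1) < \<epsilon>"
      using near assms(2,3) x(2,4) b(3,6) by blast+
    show "approx_in \<epsilon> c S" if "star_subalgebra S" "b0 \<in> S" "b1 \<in> S" for S
      using b(7)[OF that] g assms(4) unfolding approx_in_def by (intro bexI[of _ g]) auto
  qed
qed

lemma approximable_imp_gr0_le: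
  assumes "fin_dim_approximable TYPE('a::cstar_algebra)"
  shows "gr0_le TYPE('a) 1"
  unfolding gr0_le_def
proof (intro allI impI)
  fix a :: "nat \<Rightarrow> 'a" and \<epsilon> :: real and c :: 'a
  assume a: "\<forall>j\<le>1. selfadjoint (a j)" and "\<epsilon> > 0"
  obtain b0 b1 where b: "selfadjoint b0" "norm (b0 - a 0) < \<epsilon>" "selfadjoint b1" "norm (b1 - a 1) < \<epsilon>"
    "\<And>S. star_subalgebra S \<Longrightarrow> b0 \<in> S \<Longrightarrow> b1 \<in> S \<Longrightarrow> approx_in \<epsilon> c S"
    using approximable_perturb[OF assms, of "a 0" "a 1" \<epsilon> c] a \<open>\<epsilon> > 0\<close> by auto
  define b where "b j = (if j = 0 then b0 else b1)" for j :: nat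
  let ?S = "cstar_generated (b ` {..1})"
  have "b ` {..1} = {b0, b1}" by (auto simp: b_def)
  then have "b0 \<in> ?S" "b1 \<in> ?S" using cstar_generated_superset[of "b ` {..1}"] by auto
  then have "approx_in \<epsilon> c ?S"
    using b(5) sub_cstar_cstar_generated sub_cstar_iff by blast
  then show "\<exists>b. (\<forall>j\<le>1. selfadjoint (b j) \<and> norm (b j - a j) < \<epsilon>) \<and>
      approx_in \<epsilon> c (cstar_generated (b ` {..1}))"
    using b(1-4) by (intro exI[of _ b]) (auto simp: b_def le_Suc_eq)
qed

lemma gr0_le_one_imp: "gr0_le A 1 \<Longrightarrow> gr0 A \<le> 1"
  by (auto simp: gr0_def one_enat_def intro: Least_le)

lemma norm_Unz_0: "norm (Unz x 0) \<le> norm (x::'a::cstar_algebra)"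
proof -
  have "onorm (unz_op (Unz x 0)) \<le> norm x"
    by (rule onorm_bound) (simp_all add: unz_op_def norm_mult_ineq)
  then show ?thesis by (simp add: norm_unitization_def)
qed

text \<open>Adjoining the new unit to \<open>B\<close> adds one spanning element, and the resulting
  algebra is the preimage of \<open>B\<close> under \<open>unz_elem\<close>. Elements are
  approximated in their \<open>unz_elem\<close> part, with the scalar kept exactly.\<close>

lemma approximable_unitization:
  assumes "fin_dim_approximable TYPE('a::cstar_algebra)"
  shows "fin_dim_approximable TYPE('a unitization)"
  unfolding fin_dim_approximable_def
proof (intro allI impI)
  fix F :: "'a unitization set" and \<epsilon> :: real
  assume "\<epsilon> > 0" "finite F"
  then obtain B where B: "star_subalgebra B" "fin_dim B" "\<forall>x\<in>unz_elem ` F. approx_in \<epsilon> x B"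
    using assms unfolding fin_dim_approximable_def by (meson finite_imageI)
  note defs = zero_unitization_def plus_unitization_def minus_unitization_def
    times_unitization_def scaleC_unitization_def star_unitization_def
  let ?B = "unz_elem -` B"
  have "star_subalgebra ?B"
    unfolding star_subalgebra_def cvec.subspace_def using star_subalgebraD[OF B(1)]
    by (auto simp: defs)
  moreover have "fin_dim ?B"
  proof -
    obtain X where X: "finite X" "cvec.span X = B" using B(2) by (auto simp: fin_dim_def)
    let ?X = "insert (Unz 0 1) ((\<lambda>x. Unz x 0) ` X)"
    have "Unz x 0 \<in> cvec.span ?X" if "x \<in> cvec.span X" for x
      using that
    proof (induction rule: cvec.span_induct_alt)
      case base
      then show ?case using cvec.span_zero[of ?X] unfolding zero_unitization_def .
    next
      case (step c x y)
      have "Unz (c *\<^sub>C x + y) 0 = c *\<^sub>C Unz x 0 + Unz y 0" by (simp add: defs)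
      with step show ?case
        by (metis cvec.span_add cvec.span_base cvec.span_scale image_eqI insertCI)
    qed
    moreover have "u = Unz (unz_elem u) 0 + unz_scal u *\<^sub>C Unz 0 1" for u :: "'a unitization"
      by (simp add: defs)
    ultimately have "?B \<subseteq> cvec.span ?X"
      using X(2) by (metis cvec.span_add cvec.span_base cvec.span_scale insertCI subsetI vimageD)
    moreover have "cvec.span ?X \<subseteq> ?B"
    proof (rule cvec.span_minimal)
      show "?X \<subseteq> ?B" using X(2) cvec.span_base star_subalgebraD(2)[OF B(1)] by auto
      show "cvec.subspace ?B" using \<open>star_subalgebra ?B\<close> by (rule star_subalgebraD)
    qed
    ultimately show ?thesis using X(1) unfolding fin_dim_def by (intro exI[of _ ?X]) auto
  qed
  moreover have "approx_in \<epsilon> u ?B" if "u \<in> F" for u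
  proof -
    have "approx_in \<epsilon> (unz_elem u) B" using B(3) that by simp
    then obtain g where g: "g \<in> B" "norm (unz_elem u - g) < \<epsilon>" by (auto simp: approx_in_def)
    have "norm (u - Unz g (unz_scal u)) < \<epsilon>"
      using g(2) norm_Unz_0[of "unz_elem u - g"] by (simp add: defs)
    then show ?thesis unfolding approx_in_def using g(1) by (intro bexI[of _ "Unz g (unz_scal u)"]) auto
  qed
  ultimately show "\<exists>B. star_subalgebra B \<and> fin_dim B \<and> (\<forall>x\<in>F. approx_in \<epsilon> x B)" by blast
qed

lemma locally_fin_dim_imp_gr_le_one:
  assumes "locally_fin_dim TYPE('a::cstar_algebra)"
  shows "gr TYPE('a) \<le> 1"
  using locally_fin_dim_imp_approximable[OF assms]
  by (auto simp: gr_def intro!: gr0_le_one_imp approximable_imp_gr0_le approximable_unitization)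

section \<open>AF-algebras\<close>

lemma star_hom_on_image_span:
  assumes "star_hom_on (cvec.span X) f"
  shows "f ` cvec.span X = cvec.span (f ` X)"
proof
  note hom = assms[unfolded star_hom_on_def]
  have f0: "f 0 = 0"
    using hom by (metis cvec.scale_zero_left cvec.span_zero)
  show "f ` cvec.span X \<subseteq> cvec.span (f ` X)"
  proof
    fix y assume "y \<in> f ` cvec.span X"
    then obtain x where x: "x \<in> cvec.span X" "y = f x" by blast
    \<comment> \<open>\<open>f\<close> is linear only on the span, so membership in it is carried
      through the induction.\<close>
    from x(1) have "x \<in> cvec.span X \<and> f x \<in> cvec.span (f ` X)"
    proof (induction rule: cvec.span_induct_alt)
      case base
      then show ?case by (simp add: f0 cvec.span_zero)
    next
      case (step c x y)
      then have "x \<in> cvec.span X" by (simp add: cvec.span_base)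
      then have "f (c *\<^sub>C x + y) = c *\<^sub>C f x + f y"
        using step hom cvec.span_scale by metis
      with step \<open>x \<in> cvec.span X\<close> show ?case
        by (simp add: cvec.span_add cvec.span_scale cvec.span_base)
    qed
    then show "y \<in> cvec.span (f ` X)" by (simp add: x(2))
  qed
  show "cvec.span (f ` X) \<subseteq> f ` cvec.span X"
  proof (rule cvec.span_minimal)
    show "f ` X \<subseteq> f ` cvec.span X" by (intro image_mono cvec.span_superset)
    show "cvec.subspace (f ` cvec.span X)"
      unfolding cvec.subspace_def using hom f0
      by (auto simp: image_iff) (metis cvec.span_zero cvec.span_add cvec.span_scale)+
  qed
qed

lemma star_hom_on_image_star_subalgebra:
  assumes "star_subalgebra S" "star_hom_on S f"
  shows "star_subalgebra (f ` S)"
proof -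
  note S = star_subalgebraD[OF assms(1)] and hom = assms(2)[unfolded star_hom_on_def]
  have "f 0 = 0" using hom S(2) by (metis cvec.scale_zero_left)
  then have "0 \<in> f ` S" using S(2) by force
  moreover have "f x + f y \<in> f ` S" "f x * f y \<in> f ` S" "star (f x) \<in> f ` S" "c *\<^sub>C f x \<in> f ` S"
    if "x \<in> S" "y \<in> S" for x y c
    using that hom S by (metis imageI)+
  ultimately show ?thesis by (auto simp: star_subalgebra_def cvec.subspace_def)
qed

lemma AF_imp_approximable:
  assumes "AF_algebra TYPE('i) TYPE('b::cstar_algebra) TYPE('a::cstar_algebra)"
  shows "fin_dim_approximable TYPE('a)"
proof -
  obtain I :: "'i set" and le and B :: "'i \<Rightarrow> 'b set" and \<phi> and \<mu> :: "'i \<Rightarrow> 'b \<Rightarrow> 'a"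
    where lim: "is_inductive_limit I le B \<phi> \<mu>" and fd: "\<And>i. i \<in> I \<Longrightarrow> fin_dim (B i)"
    using assms unfolding AF_algebra_def by blast
  from lim[unfolded is_inductive_limit_def] have sys: "inductive_system I le B \<phi>"
    and hom: "\<forall>i\<in>I. star_hom_on (B i) (\<mu> i)"
    and compat: "\<forall>i\<in>I. \<forall>j\<in>I. le i j \<longrightarrow> (\<forall>x\<in>B i. \<mu> j (\<phi> i j x) = \<mu> i x)"
    and dense: "closure (\<Union>i\<in>I. \<mu> i ` B i) = UNIV"
    by - (elim conjE, assumption)+
  from sys[unfolded inductive_system_def] have nonempty: "I \<noteq> {}"
    and directed: "\<forall>i\<in>I. \<forall>j\<in>I. \<exists>k\<in>I. le i k \<and> le j k"
    and sub: "\<forall>i\<in>I. sub_cstar (B i)"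
    and maps: "\<forall>i\<in>I. \<forall>j\<in>I. le i j \<longrightarrow> star_hom_on (B i) (\<phi> i j) \<and> \<phi> i j ` B i \<subseteq> B j"
    by - (elim conjE, assumption)+
  have mono: "\<mu> i ` B i \<subseteq> \<mu> j ` B j" if "i \<in> I" "j \<in> I" "le i j" for i j
  proof -
    have "\<phi> i j ` B i \<subseteq> B j" using maps that by blast
    moreover have "\<mu> j (\<phi> i j x) = \<mu> i x" if "x \<in> B i" for x
      using compat \<open>i \<in> I\<close> \<open>j \<in> I\<close> \<open>le i j\<close> that by blast
    ultimately show ?thesis by (metis image_subset_iff imageI)
  qed
  have "\<exists>k\<in>I. \<forall>x\<in>F. approx_in \<epsilon> x (\<mu> k ` B k)" if "finite F" "\<epsilon> > 0" for F \<epsilon>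
    using that(1)
  proof (induction F)
    case empty
    then show ?case using nonempty by auto
  next
    case (insert x F)
    then obtain j where j: "j \<in> I" "\<forall>x\<in>F. approx_in \<epsilon> x (\<mu> j ` B j)" by blast
    have "x \<in> closure (\<Union>i\<in>I. \<mu> i ` B i)" using dense by simp
    then obtain i where i: "i \<in> I" "approx_in \<epsilon> x (\<mu> i ` B i)"
      using \<open>\<epsilon> > 0\<close> by (fastforce simp: closure_approachable approx_in_def dist_norm norm_minus_commute)
    obtain k where k: "k \<in> I" "le i k" "le j k"
      using directed i(1) j(1) by blast
    have "approx_in \<epsilon> y (\<mu> k ` B k)" if "approx_in \<epsilon> y (\<mu> h ` B h)" "h \<in> {i, j}" for y h
    proof -
      have "\<mu> h ` B h \<subseteq> \<mu> k ` B k"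
        using that(2) mono[OF i(1) k(1,2)] mono[OF j(1) k(1,3)] by blast
      then show ?thesis using that(1) unfolding approx_in_def by blast
    qed
    then show ?case using i(2) j(2) k(1) by blast
  qed
  moreover have "star_subalgebra (\<mu> k ` B k) \<and> fin_dim (\<mu> k ` B k)" if k: "k \<in> I" for k
  proof
    have "sub_cstar (B k)" using sub k by blast
    then show "star_subalgebra (\<mu> k ` B k)"
      using star_hom_on_image_star_subalgebra hom k sub_cstar_iff by blast
    obtain X where X: "finite X" "cvec.span X = B k" using fd[OF k] by (auto simp: fin_dim_def)
    then have "cvec.span (\<mu> k ` X) = \<mu> k ` B k"
      using star_hom_on_image_span[of X "\<mu> k"] hom k by simp
    then show "fin_dim (\<mu> k ` B k)" using X(1) unfolding fin_dim_def by blast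
  qed
  ultimately show ?thesis unfolding fin_dim_approximable_def by metis
qed

section \<open>Generators\<close>

lemma continuous_on_star [continuous_intros]:
  assumes "continuous_on S f"
  shows "continuous_on S (\<lambda>x. star (f x :: 'a::cstar_algebra))"
proof -
  have "continuous_on UNIV (star :: 'a \<Rightarrow> 'a)"
    by (rule continuous_onI) (metis dist_norm norm_star star_diff less_imp_le)
  then show ?thesis using assms continuous_on_compose2 by blast
qed

lemma continuous_on_scaleC [continuous_intros]:
  assumes "continuous_on S f"
  shows "continuous_on S (\<lambda>x. c *\<^sub>C (f x :: 'a::cstar_algebra))"
proof -
  have "bounded_linear (\<lambda>x::'a. c *\<^sub>C x)"
    by (rule bounded_linear_intro[where K = "cmod c"])
      (simp_all add: scaleC_add_right scaleR_conv_scaleC scaleC_scaleC norm_scaleC mult.commute)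
  then show ?thesis using assms by (rule bounded_linear.continuous_on)
qed

text \<open>Continuous operations that preserve \<open>S\<close> preserve its closure. For the
  binary ones this uses that the closure of \<open>S \<times> S\<close> is the product of the
  closures.\<close>

lemma sub_cstar_closure:
  assumes "star_subalgebra S"
  shows "sub_cstar (closure S)"
proof -
  note S = star_subalgebraD[OF assms]
  have unary: "f x \<in> closure S" if "continuous_on UNIV f" "\<And>y. y \<in> S \<Longrightarrow> f y \<in> S" "x \<in> closure S"
    for f :: "'a \<Rightarrow> 'a" and x
    using image_closure_subset[of S f "closure S"] that closure_subset[of S]
      continuous_on_subset[OF that(1)] by blast
  have binary: "f (x, y) \<in> closure S" if "continuous_on UNIV f"
    "\<And>x y. x \<in> S \<Longrightarrow> y \<in> S \<Longrightarrow> f (x, y) \<in> S" "x \<in> closure S" "y \<in> closure S"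
    for f :: "'a \<times> 'a \<Rightarrow> 'a" and x y
  proof -
    have "f ` (S \<times> S) \<subseteq> closure S" using that(2) closure_subset[of S] by auto
    then have "f ` closure (S \<times> S) \<subseteq> closure S"
      using continuous_on_subset[OF that(1)] by (intro image_closure_subset) auto
    then show ?thesis using that(3,4) by (auto simp: closure_Times)
  qed
  have "x + y \<in> closure S" "x * y \<in> closure S" if "x \<in> closure S" "y \<in> closure S" for x y
  proof -
    have "continuous_on UNIV (\<lambda>z::'a \<times> 'a. fst z + snd z)" "continuous_on UNIV (\<lambda>z::'a \<times> 'a. fst z * snd z)"
      by (intro continuous_intros)+
    then show "x + y \<in> closure S" "x * y \<in> closure S"
      using binary[of "\<lambda>z. fst z + snd z", OF _ _ that] binary[of "\<lambda>z. fst z * snd z", OF _ _ that] S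
      by simp_all
  qed
  moreover have "star x \<in> closure S" "c *\<^sub>C x \<in> closure S" if "x \<in> closure S" for x c
    using unary[of star, OF _ _ that] unary[of "\<lambda>x. c *\<^sub>C x", OF _ _ that] S
    by (simp_all add: continuous_intros)
  moreover have "0 \<in> closure S" using S(2) closure_subset by blast
  ultimately show ?thesis by (auto simp: sub_cstar_def cvec.subspace_def)
qed

text \<open>Openness rests on the density in \<open>C*(a)\<close> of the elements \<open>f a\<close>, where \<open>f\<close> is
  continuous and \<open>f x \<in> C*(x)\<close> for all \<open>x\<close>; star-polynomials in \<open>a\<close> are of this form.\<close>

lemma open_approx_in_generated:
  "open {a::'a::cstar_algebra. approx_in \<epsilon> c (cstar_generated {a})}"
proof -
  define \<F> where "\<F> = {f::'a \<Rightarrow> 'a. continuous_on UNIV f \<and> (\<forall>x. f x \<in> cstar_generated {x})}"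
  have gen: "star_subalgebra (cstar_generated {x::'a})" for x
    using sub_cstar_cstar_generated sub_cstar_iff by blast
  note closed_ops = star_subalgebraD[OF gen]
  \<comment> \<open>Each set in the union is open by continuity of \<open>f\<close>. The functions
    in \<F> do not depend on \<open>a\<close>, so one approximant serves a whole neighbourhood of
    \<open>a\<close>.\<close>
  have "(\<Union>f\<in>\<F>. {a. norm (c - f a) < \<epsilon>}) = {a. approx_in \<epsilon> c (cstar_generated {a})}"
  proof (intro equalityI subsetI)
    fix a assume "a \<in> (\<Union>f\<in>\<F>. {a. norm (c - f a) < \<epsilon>})"
    then show "a \<in> {a. approx_in \<epsilon> c (cstar_generated {a})}"
      by (auto simp: \<F>_def approx_in_def)
  next
    fix a assume "a \<in> {a. approx_in \<epsilon> c (cstar_generated {a})}"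
    then obtain g where g: "g \<in> cstar_generated {a}" "norm (c - g) < \<epsilon>" by (auto simp: approx_in_def)
    \<comment> \<open>The values at \<open>a\<close> form a star-subalgebra containing
      \<open>a\<close>, through the identity function, so \<open>C*(a)\<close> lies in its
      closure.\<close>
    define S where "S = (\<lambda>f. f a) ` \<F>"
    have "star_subalgebra S"
      unfolding star_subalgebra_def cvec.subspace_def
    proof (intro conjI ballI allI)
      show "0 \<in> S" unfolding S_def
        by (rule image_eqI[of _ _ "\<lambda>_. 0"]) (auto simp: \<F>_def closed_ops)
      fix x assume "x \<in> S"
      then obtain f where f: "f \<in> \<F>" "x = f a" by (auto simp: S_def)
      show "star x \<in> S" unfolding S_def
        by (rule image_eqI[of _ _ "\<lambda>x. star (f x)"])
          (use f in \<open>auto simp: \<F>_def closed_ops intro: continuous_on_star\<close>)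
      show "k *\<^sub>C x \<in> S" for k unfolding S_def
        by (rule image_eqI[of _ _ "\<lambda>x. k *\<^sub>C f x"])
          (use f in \<open>auto simp: \<F>_def closed_ops intro: continuous_on_scaleC\<close>)
      fix y assume "y \<in> S"
      then obtain h where h: "h \<in> \<F>" "y = h a" by (auto simp: S_def)
      show "x + y \<in> S" unfolding S_def
        by (rule image_eqI[of _ _ "\<lambda>x. f x + h x"])
          (use f h in \<open>auto simp: \<F>_def closed_ops intro: continuous_on_add\<close>)
      show "x * y \<in> S" unfolding S_def
        by (rule image_eqI[of _ _ "\<lambda>x. f x * h x"])
          (use f h in \<open>auto simp: \<F>_def closed_ops intro: continuous_on_mult\<close>)
    qed
    moreover have "a \<in> S" unfolding S_def
      by (rule image_eqI[of _ _ "\<lambda>x. x"]) (use cstar_generated_superset in \<open>auto simp: \<F>_def\<close>)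
    ultimately have "cstar_generated {a} \<subseteq> closure S"
      using sub_cstar_closure closure_subset by (intro cstar_generated_minimal) auto
    then have "g \<in> closure S" using g(1) by blast
    moreover have "0 < \<epsilon> - norm (c - g)" using g(2) by simp
    ultimately obtain h where h: "h \<in> S" "dist h g < \<epsilon> - norm (c - g)"
      unfolding closure_approachable by blast
    then obtain f where f: "f \<in> \<F>" "h = f a" by (auto simp: S_def)
    have "norm (c - f a) < \<epsilon>"
      using h(2) norm_triangle_ineq[of "c - g" "g - h"] by (simp add: dist_norm norm_minus_commute f(2))
    then show "a \<in> (\<Union>f\<in>\<F>. {a. norm (c - f a) < \<epsilon>})" using f(1) by blast
  qed
  moreover have "open (\<Union>f\<in>\<F>. {a. norm (c - f a) < \<epsilon>})"
    by (intro open_UN ballI open_Collect_less continuous_intros) (auto simp: \<F>_def)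
  ultimately show ?thesis by simp
qed

text \<open>Perturb the two self-adjoint parts of \<open>a\<close> and recombine them into
  \<open>b\<close>. They are recovered from \<open>b\<close> and \<open>star b\<close>, so
  \<open>C*(b)\<close> contains both.\<close>

lemma dense_approx_in_generated:
  assumes "fin_dim_approximable TYPE('a::cstar_algebra)" "\<epsilon> > 0"
  shows "closure {a::'a. approx_in \<epsilon> c (cstar_generated {a})} = UNIV"
proof -
  have "\<exists>b\<in>{a. approx_in \<epsilon> c (cstar_generated {a})}. dist b a < \<delta>" if "\<delta> > 0" for a :: 'a and \<delta>
  proof -
    \<comment> \<open>Two errors below \<open>\<delta> / 2\<close> add up to less than \<delta>, and
      \<open>\<eta> \<le> \<epsilon>\<close> serves the approximation of \<open>c\<close>.\<close>
    define \<eta> where "\<eta> = min (\<delta> / 2) \<epsilon>"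
    have "\<eta> > 0" using that assms(2) by (simp add: \<eta>_def)
    obtain b0 b1 where b: "selfadjoint b0" "norm (b0 - re_part a) < \<eta>"
      "selfadjoint b1" "norm (b1 - im_part a) < \<eta>"
      "\<And>S. star_subalgebra S \<Longrightarrow> b0 \<in> S \<Longrightarrow> b1 \<in> S \<Longrightarrow> approx_in \<eta> c S"
      using approximable_perturb[OF assms(1) selfadjoint_re_part[of a] selfadjoint_im_part[of a] \<open>\<eta> > 0\<close>]
      by metis
    define b where "b = b0 + \<i> *\<^sub>C b1"
    let ?S = "cstar_generated {b}"
    have S: "star_subalgebra ?S" using sub_cstar_cstar_generated sub_cstar_iff by blast
    have "b \<in> ?S" using cstar_generated_superset by blast
    then have "b0 \<in> ?S" "b1 \<in> ?S"
      using re_im_part_closed[OF S] re_part_combination[OF b(1,3)] unfolding b_def by metis+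
    with b(5)[OF S] have "approx_in \<epsilon> c ?S" by (auto simp: approx_in_def \<eta>_def)
    moreover have "dist b a < \<delta>"
    proof -
      have "b - a = (b0 - re_part a) + \<i> *\<^sub>C (b1 - im_part a)"
      proof -
        have "b - a = b0 + \<i> *\<^sub>C b1 - (re_part a + \<i> *\<^sub>C im_part a)"
          by (simp add: b_def re_part_plus_im_part)
        then show ?thesis by (simp add: cvec.scale_right_diff_distrib)
      qed
      then have "norm (b - a) \<le> norm (b0 - re_part a) + norm (b1 - im_part a)"
        by (metis norm_triangle_ineq norm_scaleC norm_ii mult_1)
      also have "\<dots> < \<delta>" using b(2,4) by (simp add: \<eta>_def)
      finally show ?thesis by (simp add: dist_norm)
    qed
    ultimately show ?thesis by blast
  qed
  then show ?thesis by (auto simp: closure_approachable)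
qed

text \<open>\<open>C*(a)\<close> is closed, so it is everything once it approximates each element of
  a dense set arbitrarily well. For countable \<open>C\<close> the intersection is
  countable.\<close>

lemma generators_eq_INT:
  assumes "closure C = UNIV"
  shows "{a::'a::cstar_algebra. cstar_generated {a} = UNIV} =
    (\<Inter>(c, n)\<in>C \<times> (UNIV::nat set). {a. approx_in (1 / Suc n) c (cstar_generated {a})})"
    (is "?L = ?R")
proof (intro equalityI subsetI)
  fix a assume "a \<in> ?L"
  moreover have "approx_in (1 / Suc n) c UNIV" for c :: 'a and n
    unfolding approx_in_def by (intro bexI[of _ c]) auto
  ultimately show "a \<in> ?R" by auto
next
  fix a assume a: "a \<in> ?R"
  have cl: "closed (cstar_generated {a})" using sub_cstar_cstar_generated sub_cstar_iff by blast
  have "c \<in> closure (cstar_generated {a})" if "c \<in> C" for c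
    unfolding closure_approachable
  proof (intro allI impI)
    fix e :: real assume "e > 0"
    then obtain n where n: "1 / Suc n < e" using nat_approx_posE by blast
    have "approx_in (1 / Suc n) c (cstar_generated {a})" using a that by blast
    then obtain g where "g \<in> cstar_generated {a}" "norm (c - g) < 1 / Suc n"
      unfolding approx_in_def by blast
    then show "\<exists>y\<in>cstar_generated {a}. dist y c < e"
      using n by (intro bexI[of _ g]) (auto simp: dist_norm norm_minus_commute)
  qed
  then have "C \<subseteq> cstar_generated {a}" using cl by auto
  then have "closure C \<subseteq> cstar_generated {a}" using cl by (rule closure_minimal)
  then show "a \<in> ?L" using assms by auto
qed

lemma generators_dense_gdelta:
  assumes sep: "separable_space (euclidean :: 'a::cstar_algebra topology)"
    and approx: "fin_dim_approximable TYPE('a)"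
  shows "gdelta_in euclidean {a::'a. cstar_generated {a} = UNIV}"
    "closure {a::'a. cstar_generated {a} = UNIV} = UNIV"
proof -
  obtain C :: "'a set" where C: "countable C" "closure C = UNIV"
    using sep by (auto simp: separable_space_def)
  define \<G> where "\<G> = (\<lambda>(c::'a, n::nat). {a. approx_in (1 / Suc n) c (cstar_generated {a})}) ` (C \<times> UNIV)"
  have eq: "{a::'a. cstar_generated {a} = UNIV} = \<Inter>\<G>"
    unfolding generators_eq_INT[OF C(2)] \<G>_def ..
  have count: "countable \<G>" using C(1) by (simp add: \<G>_def)
  have op: "open T" if "T \<in> \<G>" for T
    using that open_approx_in_generated by (auto simp: \<G>_def)
  have de: "closure T = UNIV" if "T \<in> \<G>" for T
    using that dense_approx_in_generated[OF approx] by (auto simp: \<G>_def)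
  show "gdelta_in euclidean {a::'a. cstar_generated {a} = UNIV}"
    unfolding eq gdelta_in_alt intersection_of_def using count op by auto
  \<comment> \<open>Completeness of the norm is what Baire's theorem requires.\<close>
  have "Metric_space.mcomplete (UNIV :: 'a set) dist"
    by (simp add: complete_UNIV)
  then show "closure {a::'a. cstar_generated {a} = UNIV} = UNIV"
    unfolding eq using Met_TC.metric_Baire_category[of \<G>] count op de by auto
qed

theorem theorem7p3:
  shows "(locally_fin_dim TYPE('a::cstar_algebra) \<longrightarrow> gr TYPE('a) \<le> 1) \<and>
    (separable_space (euclidean :: 'a topology) \<and>
       AF_algebra TYPE('i) TYPE('b::cstar_algebra) TYPE('a) \<longrightarrow>
     gdelta_in euclidean {a::'a. cstar_generated {a} = UNIV} \<and>
     closure {a::'a. cstar_generated {a} = UNIV} = UNIV \<and>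
     (\<exists>a::'a. cstar_generated {a} = UNIV))"
proof (intro conjI impI)
  show "locally_fin_dim TYPE('a) \<Longrightarrow> gr TYPE('a) \<le> 1"
    by (rule locally_fin_dim_imp_gr_le_one)
  assume "separable_space (euclidean :: 'a topology) \<and>
    AF_algebra TYPE('i) TYPE('b) TYPE('a)"
  then have sep: "separable_space (euclidean :: 'a topology)"
    and approx: "fin_dim_approximable TYPE('a)"
    using AF_imp_approximable by blast+
  show "gdelta_in euclidean {a::'a. cstar_generated {a} = UNIV}"
    by (rule generators_dense_gdelta(1)[OF sep approx])
  show dense: "closure {a::'a. cstar_generated {a} = UNIV} = UNIV"
    by (rule generators_dense_gdelta(2)[OF sep approx])
  show "\<exists>a::'a. cstar_generated {a} = UNIV"
  proof (rule ccontr)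
    assume "\<nexists>a::'a. cstar_generated {a} = UNIV"
    then have "{a::'a. cstar_generated {a} = UNIV} = {}" by blast
    with dense show False by simp
  qed
qed

end
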